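(* Let $F\subset\mathbb{R}^n$ be non-empty and compact. Suppose that there are compact sets $E_i\subset\mathbb{R}$ and numbers $1\ge s_1\ge\cdots\ge s_n\ge0$ such that $$F\subset E_1\times\cdots\times E_n,\qquad 0<\mathcal H^{s_i}(E_i)<\infty,\qquad \overline{\dim}_{\mathrm B}E_i=s_i\quad(1\le i\le n).$$ Let $\nu=\bigotimes_{i=1}^n\bigl(\mathcal H^{s_i}|_{E_i}\bigr)$. If $\nu(F)>0$, then $$\mathrm P_{\mathrm H}(F)=\underline{\mathrm P}(F)=\Bigl\{\alpha\in[0,\infty)^n:\ \sum_{i=k}^n\alpha_i\le\sum_{i=k}^ns_i\ \text{ for }1\le k\le n\Bigr\}.$$
   Context: $\mathcal H^s$ is $s$-dimensional Hausdorff measure on $\mathbb{R}$, $\mathcal H^{s}|_{E}$ its restriction to $E$, and $\overline{\dim}_{\mathrm B}$ is upper box (Minkowski) dimension. An open box in $\mathbb{R}^n$ is an open rectangular box with positive side lengths and arbitrary orientation; its side lengths in decreasing order are $l_1(B)\ge\cdots\ge l_n(B)>0$. Let $\Delta_n=\{\delta\in(0,1)^n:\delta_1\ge\cdots\ge\delta_n\}$. For non-empty bounded $F\subset\mathbb{R}^n$ and $\delta\in\Delta_n$, $N(F;\delta)$ is the least number of open boxes $B$ needed to cover $F$, subject to $l_i(B)\le\delta_i$ for $1\le i\le n$ for every box in the cover (boxes may have different orientations). For $\alpha\in[0,\infty)^n$ write $\delta^\alpha=\prod_i\delta_i^{\alpha_i}$. The lower box dimension print is $$\underline{\mathrm P}(F)=\Bigl\{\alpha\in[0,\infty)^n:\liminf_{\delta\in\Delta_n,\,\delta_1\downarrow0}N(F;\delta)\delta^\alpha>0\Bigr\},$$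 the lower limit being over all of $\Delta_n$ as $\delta_1\downarrow0$. Hausdorff dimension print: for $\alpha\in[0,\infty)^n$ and a box $B$ put $r^\alpha(B)=\prod_{i=1}^n l_i(B)^{\alpha_i}$. For $\eta>0$ let $\mu^\alpha_\eta(E)=\inf\{\sum_jr^\alpha(B_j)\}$, the infimum over finite or countable covers of $E$ by open boxes $B_j$ with $\operatorname{diam}B_j\le\eta$, and $\mu^\alpha(E)=\lim_{\eta\downarrow0}\mu^\alpha_\eta(E)$. Then $\mathrm P_{\mathrm H}(E)=\{\alpha\in[0,\infty)^n:\mu^\alpha(E)>0\}$. *)

theory Defs
  imports "HOL-Analysis.Analysis"
begin

section \<open>Hausdorff measure\<close>

text \<open>
  The contribution \<open>|U|\<^sup>s\<close> of a covering set. The case distinction is needed because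
  \<open>0 powr 0 = 0\<close>, whereas for \<open>s = 0\<close> each non-empty set has to contribute 1
  (so that the 0-dimensional measure is counting measure).
\<close>

definition hausdorff_gauge :: "real \<Rightarrow> 'a::metric_space set \<Rightarrow> real" where
  "hausdorff_gauge s U = (if U = {} then 0 else if s = 0 then 1 else diameter U powr s)"

definition hausdorff_content :: "real \<Rightarrow> real \<Rightarrow> 'a::metric_space set \<Rightarrow> ennreal" where
  "hausdorff_content s \<eta> A =
     (INF U \<in> {U :: nat \<Rightarrow> 'a set. A \<subseteq> (\<Union>j. U j) \<and> (\<forall>j. bounded (U j) \<and> diameter (U j) \<le> \<eta>)}.
        \<Sum>j. ennreal (hausdorff_gauge s (U j)))"

definition hausdorff_outer :: "real \<Rightarrow> 'a::metric_space set \<Rightarrow> ennreal" where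
  "hausdorff_outer s A = (SUP \<eta>\<in>{0<..}. hausdorff_content s \<eta> A)"

text \<open>
  Hausdorff measure without normalising constant, as a measure on the Borel sets. The lemma
  \<open>emeasure_hausdorff_measure\<close> below shows that it agrees with the outer measure there.
\<close>

definition hausdorff_measure :: "real \<Rightarrow> 'a::metric_space measure" where
  "hausdorff_measure s = measure_of UNIV (sets borel) (hausdorff_outer s)"

lemma space_hausdorff_measure [simp]: "space (hausdorff_measure s) = UNIV"
  by (simp add: hausdorff_measure_def space_measure_of_conv)

lemma sets_hausdorff_measure [simp, measurable_cong]: "sets (hausdorff_measure s) = sets borel"
  unfolding hausdorff_measure_def
  by (metis sets.sets_measure_of_eq space_borel)

lemma hausdorff_content_mono:
  "A \<subseteq> B \<Longrightarrow> hausdorff_content s \<eta> A \<le> hausdorff_content s \<eta> B"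
  unfolding hausdorff_content_def by (rule INF_superset_mono) auto

lemma hausdorff_content_antimono:
  "\<eta> \<le> \<eta>' \<Longrightarrow> hausdorff_content s \<eta>' A \<le> hausdorff_content s \<eta> A"
  unfolding hausdorff_content_def by (rule INF_superset_mono) (auto intro: order_trans)

lemma hausdorff_outer_mono: "A \<subseteq> B \<Longrightarrow> hausdorff_outer s A \<le> hausdorff_outer s B"
  unfolding hausdorff_outer_def by (intro SUP_mono) (auto intro: hausdorff_content_mono)

lemma hausdorff_content_le:
  assumes "A \<subseteq> (\<Union>j. U j)" "\<And>j. bounded (U j)" "\<And>j::nat. diameter (U j) \<le> \<eta>"
  shows "hausdorff_content s \<eta> A \<le> (\<Sum>j. ennreal (hausdorff_gauge s (U j)))"
  unfolding hausdorff_content_def using assms by (intro INF_lower) auto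

lemma hausdorff_content_empty [simp]:
  assumes "\<eta> > 0" shows "hausdorff_content s \<eta> ({} :: 'a::metric_space set) = 0"
proof -
  have "hausdorff_content s \<eta> ({} :: 'a set) \<le> (\<Sum>j::nat. ennreal (hausdorff_gauge s ({} :: 'a set)))"
    using assms by (intro hausdorff_content_le[where U = "\<lambda>_. {}"]) auto
  thus ?thesis by (simp add: hausdorff_gauge_def)
qed

lemma hausdorff_outer_empty [simp]: "hausdorff_outer s {} = 0"
  unfolding hausdorff_outer_def by (simp add: SUP_constant cong: SUP_cong_simp)

lemma hausdorff_content_countably_subadditive:
  fixes A :: "nat \<Rightarrow> 'a::metric_space set"
  shows "hausdorff_content s \<eta> (\<Union>i. A i) \<le> (\<Sum>i. hausdorff_content s \<eta> (A i))"
proof (cases "(\<Sum>i. hausdorff_content s \<eta> (A i)) = top")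
  case False
  hence fin: "hausdorff_content s \<eta> (A i) < top" for i
    by (metis ennreal_suminf_lessD top.not_eq_extremum)
  show ?thesis
  proof (rule ennreal_le_epsilon)
    fix e :: real assume e: "e > 0"
    have "\<exists>U. A i \<subseteq> (\<Union>j. U j) \<and> (\<forall>j. bounded (U j) \<and> diameter (U j) \<le> \<eta>) \<and>
        (\<Sum>j. ennreal (hausdorff_gauge s (U j))) \<le> hausdorff_content s \<eta> (A i) + ennreal (e * (1/2)^Suc i)"
      for i
    proof -
      have "hausdorff_content s \<eta> (A i) < hausdorff_content s \<eta> (A i) + ennreal (e * (1/2)^Suc i)"
        using fin[of i] e by (simp add: ennreal_zero_less_mult_iff ennreal_add_left_cancel_less
            less_top[symmetric] flip: ennreal_mult)
      from this[unfolded hausdorff_content_def[of s \<eta> "A i"] INF_less_iff]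
      show ?thesis unfolding hausdorff_content_def[of s \<eta> "A i"] by (auto intro: less_imp_le)
    qed
    then obtain U where U: "\<And>i. A i \<subseteq> (\<Union>j. U i j)" "\<And>i j. bounded (U i j)"
        "\<And>i j::nat. diameter (U i j) \<le> \<eta>"
        "\<And>i. (\<Sum>j. ennreal (hausdorff_gauge s (U i j))) \<le>
            hausdorff_content s \<eta> (A i) + ennreal (e * (1/2)^Suc i)"
      by metis
    define V where "V n = case_prod U (prod_decode n)" for n
    have "(\<Union>i. A i) \<subseteq> (\<Union>n. V n)"
    proof
      fix x assume "x \<in> (\<Union>i. A i)"
      then obtain i j where "x \<in> U i j" using U(1) by blast
      hence "x \<in> V (prod_encode (i, j))" by (simp add: V_def)
      thus "x \<in> (\<Union>n. V n)" by blast
    qed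
    hence "hausdorff_content s \<eta> (\<Union>i. A i) \<le> (\<Sum>n. ennreal (hausdorff_gauge s (V n)))"
      using U(2,3) by (intro hausdorff_content_le) (auto simp: V_def split: prod.splits)
    also have "\<dots> = (\<Sum>i. \<Sum>j. ennreal (hausdorff_gauge s (U i j)))"
      using suminf_ennreal_2dimen[of "\<lambda>i. \<Sum>j. ennreal (hausdorff_gauge s (U i j))"
          "\<lambda>(i, j). ennreal (hausdorff_gauge s (U i j))"]
      by (simp add: V_def comp_def case_prod_unfold)
    also have "\<dots> \<le> (\<Sum>i. hausdorff_content s \<eta> (A i) + ennreal (e * (1/2)^Suc i))"
      by (intro suminf_le U(4)) auto
    also have "\<dots> = (\<Sum>i. hausdorff_content s \<eta> (A i)) + (\<Sum>i. ennreal (e * (1/2)^Suc i))"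
      by (intro suminf_add[symmetric]) auto
    also have "(\<Sum>i. ennreal (e * (1/2)^Suc i)) = ennreal e"
      using sums_mult[OF power_half_series, of e] e by (intro suminf_ennreal_eq) auto
    finally show "hausdorff_content s \<eta> (\<Union>i. A i) \<le> (\<Sum>i. hausdorff_content s \<eta> (A i)) + ennreal e" .
  qed
qed simp

lemma hausdorff_outer_countably_subadditive:
  fixes A :: "nat \<Rightarrow> 'a::metric_space set"
  shows "hausdorff_outer s (\<Union>i. A i) \<le> (\<Sum>i. hausdorff_outer s (A i))"
  unfolding hausdorff_outer_def[of s "\<Union>i. A i"]
proof (rule SUP_least)
  fix \<eta> :: real assume "\<eta> \<in> {0<..}"
  hence "(\<Sum>i. hausdorff_content s \<eta> (A i)) \<le> (\<Sum>i. hausdorff_outer s (A i))"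
    unfolding hausdorff_outer_def by (intro suminf_le SUP_upper) auto
  thus "hausdorff_content s \<eta> (\<Union>i. A i) \<le> (\<Sum>i. hausdorff_outer s (A i))"
    using hausdorff_content_countably_subadditive order_trans by blast
qed

lemma outer_measure_space_hausdorff_outer: "outer_measure_space (Pow UNIV) (hausdorff_outer s)"
  by (simp add: outer_measure_space_def positive_def increasing_def countably_subadditive_def
      hausdorff_outer_mono hausdorff_outer_countably_subadditive)

lemma hausdorff_outer_Un_le: "hausdorff_outer s (A \<union> B) \<le> hausdorff_outer s A + hausdorff_outer s B"
proof -
  have "hausdorff_outer s (A \<union> B) = hausdorff_outer s (\<Union>i. binaryset A B i)"
    by (simp add: UN_binaryset_eq)
  also have "\<dots> \<le> (\<Sum>i. hausdorff_outer s (binaryset A B i))"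
    by (rule hausdorff_outer_countably_subadditive)
  also have "\<dots> = hausdorff_outer s A + hausdorff_outer s B"
    by (intro suminf_binaryset_eq) auto
  finally show ?thesis .
qed

lemma hausdorff_content_separated:
  assumes sep: "\<And>x y. x \<in> A \<Longrightarrow> y \<in> B \<Longrightarrow> dist x y > \<eta>"
  shows "hausdorff_content s \<eta> A + hausdorff_content s \<eta> B \<le> hausdorff_content s \<eta> (A \<union> B)"
  unfolding hausdorff_content_def[of s \<eta> "A \<union> B"]
proof (rule INF_greatest, clarify)
  fix U :: "nat \<Rightarrow> 'a set"
  assume cov: "A \<union> B \<subseteq> (\<Union>j. U j)" and U: "\<forall>j. bounded (U j) \<and> diameter (U j) \<le> \<eta>"
  have \<eta>: "\<eta> \<ge> 0" using U diameter_ge_0 order_trans by blast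
  define V where "V C j = (if U j \<inter> C = {} then {} else U j)" for C j
  have V: "hausdorff_content s \<eta> C \<le> (\<Sum>j. ennreal (hausdorff_gauge s (V C j)))" if sub: "C \<subseteq> A \<union> B" for C
  proof (rule hausdorff_content_le)
    show "C \<subseteq> (\<Union>j. V C j)"
    proof
      fix x assume x: "x \<in> C"
      then obtain j where "x \<in> U j" using sub cov by blast
      with x have "x \<in> V C j" by (auto simp: V_def)
      thus "x \<in> (\<Union>j. V C j)" by blast
    qed
  qed (use U \<eta> in \<open>auto simp: V_def\<close>)
  have "U j \<inter> A = {} \<or> U j \<inter> B = {}" for j
  proof (rule ccontr)
    assume "\<not> ?thesis"
    then obtain x y where xy: "x \<in> U j" "x \<in> A" "y \<in> U j" "y \<in> B" by blast
    have "dist x y \<le> \<eta>" using diameter_bounded_bound[of "U j" x y] U xy order_trans by blast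
    with sep[of x y] xy show False by simp
  qed
  hence "ennreal (hausdorff_gauge s (V A j)) + ennreal (hausdorff_gauge s (V B j))
      \<le> ennreal (hausdorff_gauge s (U j))" for j
    by (auto simp: V_def hausdorff_gauge_def)
  hence "(\<Sum>j. ennreal (hausdorff_gauge s (V A j)) + ennreal (hausdorff_gauge s (V B j)))
      \<le> (\<Sum>j. ennreal (hausdorff_gauge s (U j)))"
    by (intro suminf_le) auto
  moreover have "hausdorff_content s \<eta> A + hausdorff_content s \<eta> B \<le>
      (\<Sum>j. ennreal (hausdorff_gauge s (V A j))) + (\<Sum>j. ennreal (hausdorff_gauge s (V B j)))"
    by (intro add_mono V) auto
  ultimately show "hausdorff_content s \<eta> A + hausdorff_content s \<eta> B
      \<le> (\<Sum>j. ennreal (hausdorff_gauge s (U j)))"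
    by (simp add: suminf_add)
qed

lemma hausdorff_outer_separated:
  assumes sep: "\<And>x y. x \<in> A \<Longrightarrow> y \<in> B \<Longrightarrow> dist x y \<ge> e" and e: "e > 0"
  shows "hausdorff_outer s A + hausdorff_outer s B \<le> hausdorff_outer s (A \<union> B)"
proof -
  have "hausdorff_content s a A + hausdorff_content s b B \<le> hausdorff_outer s (A \<union> B)"
    if "a > 0" "b > 0" for a b
  proof -
    define \<eta> where "\<eta> = Min {a, b, e / 2}"
    have \<eta>: "\<eta> > 0" "\<eta> \<le> a" "\<eta> \<le> b" "\<eta> < e" using that e by (auto simp: \<eta>_def min_less_iff_disj)
    have "hausdorff_content s a A + hausdorff_content s b B \<le>
        hausdorff_content s \<eta> A + hausdorff_content s \<eta> B"
      using \<eta> by (intro add_mono hausdorff_content_antimono)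
    also have "\<dots> \<le> hausdorff_content s \<eta> (A \<union> B)"
      using \<eta> sep by (intro hausdorff_content_separated) (meson less_le_trans)
    also have "\<dots> \<le> hausdorff_outer s (A \<union> B)"
      unfolding hausdorff_outer_def using \<eta> by (intro SUP_upper) auto
    finally show ?thesis .
  qed
  hence "hausdorff_content s a A + hausdorff_outer s B \<le> hausdorff_outer s (A \<union> B)" if "a > 0" for a
    unfolding hausdorff_outer_def[of s B] using that
    by (subst ennreal_SUP_add_right) (auto intro!: SUP_least)
  thus ?thesis
    unfolding hausdorff_outer_def[of s A]
    by (subst ennreal_SUP_add_left[symmetric]) (auto intro!: SUP_least)
qed

lemma hausdorff_outer_closed_split:
  fixes A T :: "'a::metric_space set"
  assumes A: "closed A"
  shows "hausdorff_outer s (T \<inter> A) + hausdorff_outer s (T - A) \<le> hausdorff_outer s T"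
proof (cases "A = {} \<or> hausdorff_outer s T = top")
  case False
  let ?H = "hausdorff_outer s"
  from False have ne: "A \<noteq> {}" and fin: "?H T < top" by (auto simp: less_top)
  define t :: "nat \<Rightarrow> real" where "t n = 1 / (real n + 1)" for n
  have t_less: "t m < t n" if "n < m" for m n using that by (simp add: t_def frac_less2)
  have t_pos: "t n > 0" for n by (simp add: t_def)
  have t_lim: "\<exists>n. t n < d" if "d > 0" for d
    using that reals_Archimedean[of d] by (auto simp: t_def inverse_eq_divide add.commute)
  define X where "X n = {x\<in>T. infdist x A > t n}" for n
  define R where "R n = {x\<in>T. t (n + 2) < infdist x A \<and> infdist x A \<le> t (n + 1)}" for n
  have sep: "?H C + ?H D \<le> ?H (C \<union> D)"
    if "\<And>x. x \<in> C \<Longrightarrow> infdist x A \<le> a" "\<And>x. x \<in> D \<Longrightarrow> infdist x A > b" "a < b" for C D a b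
  proof (rule hausdorff_outer_separated[of _ _ "b - a"])
    fix x y assume "x \<in> C" "y \<in> D"
    thus "b - a \<le> dist x y"
      using that(1)[of x] that(2)[of y] infdist_triangle[of y A x] by (simp add: dist_commute)
  qed (use that in auto)
  have parity: "(\<Sum>k<m. ?H (R (2 * k + p))) \<le> ?H T" for m p
  proof -
    have "(\<Sum>k<m. ?H (R (2 * k + p))) \<le> ?H (X (2 * m + p))"
    proof (induction m)
      case (Suc m)
      have "(\<Sum>k<Suc m. ?H (R (2 * k + p))) \<le> ?H (R (2 * m + p)) + ?H (X (2 * m + p))"
        using Suc by (simp add: add.commute add_left_mono)
      also have "\<dots> \<le> ?H (R (2 * m + p) \<union> X (2 * m + p))"
        by (rule sep[of _ "t (2 * m + p + 1)" _ "t (2 * m + p)"]) (auto simp: R_def X_def t_less)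
      also have "\<dots> \<le> ?H (X (2 * Suc m + p))"
        using t_less[of "2 * m + p" "2 * m + p + 2"]
        by (intro hausdorff_outer_mono) (auto simp: R_def X_def)
      finally show ?case .
    qed auto
    also have "\<dots> \<le> ?H T" by (intro hausdorff_outer_mono) (auto simp: X_def)
    finally show ?thesis .
  qed
  define S where "S = (\<Sum>k. ?H (R k))"
  have "S \<le> ?H T + ?H T"
    unfolding S_def
  proof (rule suminf_le_const)
    fix n
    have "(\<Sum>k<n. ?H (R k)) \<le> (\<Sum>k<2*n. ?H (R k))" by (intro sum_mono2) auto
    also have "\<dots> = (\<Sum>k<n. ?H (R (2 * k + 0))) + (\<Sum>k<n. ?H (R (2 * k + 1)))"
      by (induction n) (auto simp: algebra_simps)
    also have "\<dots> \<le> ?H T + ?H T" by (intro add_mono parity)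
    finally show "(\<Sum>k<n. ?H (R k)) \<le> ?H T + ?H T" .
  qed auto
  hence S_fin: "S < top" using fin by (simp add: le_less_trans)
  have bound: "?H (T \<inter> A) + ?H (T - A) + (\<Sum>k<n. ?H (R k)) \<le> ?H T + S" for n
  proof -
    have sub: "T - A \<subseteq> X (n + 1) \<union> (\<Union>k. R (k + n))"
    proof
      fix x assume x: "x \<in> T - A"
      hence d: "infdist x A > 0" using A ne infdist_pos_not_in_closed by blast
      show "x \<in> X (n + 1) \<union> (\<Union>k. R (k + n))"
      proof (cases "infdist x A > t (n + 1)")
        case False
        define m where "m = (LEAST m. t m < infdist x A)"
        have m: "t m < infdist x A" unfolding m_def using t_lim[OF d] by (rule LeastI_ex)
        have m': "\<not> t k < infdist x A" if "k < m" for k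
          using that not_less_Least unfolding m_def by blast
        have "m > n + 1"
        proof (rule ccontr)
          assume "\<not> m > n + 1"
          hence "t (n + 1) \<le> t m" using t_less[of m "n + 1"] by (cases "m = n + 1") auto
          with m False show False by simp
        qed
        then obtain j where j: "m = j + n + 2" by (metis add.assoc add.commute less_natE Suc_eq_plus1 add_2_eq_Suc')
        have "x \<in> R (j + n)" using m m'[of "j + n + 1"] x j by (auto simp: R_def)
        thus ?thesis by blast
      qed (use x in \<open>auto simp: X_def\<close>)
    qed
    have "?H (T - A) \<le> ?H (X (n + 1)) + ?H (\<Union>k. R (k + n))"
      using hausdorff_outer_mono[OF sub] hausdorff_outer_Un_le order_trans by blast
    also have "\<dots> \<le> ?H (X (n + 1)) + (\<Sum>k. ?H (R (k + n)))"
      by (intro add_left_mono hausdorff_outer_countably_subadditive)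
    finally have "?H (T - A) + (\<Sum>k<n. ?H (R k)) \<le> ?H (X (n + 1)) + S"
      unfolding S_def by (subst suminf_offset[of _ n]) (auto simp: add.assoc add.commute add_left_mono)
    hence "?H (T \<inter> A) + ?H (T - A) + (\<Sum>k<n. ?H (R k)) \<le> ?H (T \<inter> A) + ?H (X (n + 1)) + S"
      by (simp add: add.assoc add_left_mono)
    also have "?H (T \<inter> A) + ?H (X (n + 1)) \<le> ?H (T \<inter> A \<union> X (n + 1))"
      by (rule sep[of _ 0 _ "t (n + 1)"]) (auto simp: X_def t_pos)
    also have "\<dots> \<le> ?H T" by (intro hausdorff_outer_mono) (auto simp: X_def)
    finally show ?thesis by (simp add: add_right_mono)
  qed
  have "(\<lambda>n. ?H (T \<inter> A) + ?H (T - A) + (\<Sum>k<n. ?H (R k))) \<longlonglongrightarrow> ?H (T \<inter> A) + ?H (T - A) + S"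
    unfolding S_def by (intro tendsto_add tendsto_const summable_LIMSEQ) auto
  hence "?H (T \<inter> A) + ?H (T - A) + S \<le> ?H T + S"
    using bound by (intro LIMSEQ_le_const2) auto
  thus ?thesis using S_fin by (auto simp: add.commute ennreal_add_left_cancel_le)
qed auto

lemma measure_space_hausdorff_outer:
  "measure_space UNIV (sets (borel :: 'a::metric_space measure)) (hausdorff_outer s)"
proof -
  let ?L = "lambda_system UNIV (Pow UNIV) (hausdorff_outer s) :: 'a set set"
  interpret P: sigma_algebra "UNIV :: 'a set" "Pow UNIV" by (rule sigma_algebra_Pow)
  have L: "measure_space UNIV ?L (hausdorff_outer s)"
    by (rule P.caratheodory_lemma[OF outer_measure_space_hausdorff_outer])
  then interpret L: sigma_algebra UNIV ?L by (simp add: measure_space_def)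
  have "A \<in> ?L" if "closed A" for A
  proof -
    have "hausdorff_outer s (T \<inter> A) + hausdorff_outer s (T - A) = hausdorff_outer s T" for T
      using hausdorff_outer_closed_split[OF that, of s T]
        hausdorff_outer_Un_le[of s "T \<inter> A" "T - A"] by (simp add: Int_Diff_Un antisym)
    thus ?thesis unfolding P.lambda_system_eq by blast
  qed
  hence "sets borel \<subseteq> ?L"
    unfolding borel_eq_closed by (subst sets_measure_of) (auto intro!: L.sigma_sets_subset simp del: Pow_UNIV)
  thus ?thesis
    using L by (rule measure_down[rotated 2]) (use sets.sigma_algebra_axioms[of borel] in simp)
qed

lemma emeasure_hausdorff_measure:
  assumes "A \<in> sets borel"
  shows "emeasure (hausdorff_measure s) A = hausdorff_outer s A"
  using measure_space_hausdorff_outer[of s] assms unfolding hausdorff_measure_def measure_space_def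
  by (intro emeasure_measure_of_sigma) auto


section \<open>Upper box dimension\<close>

definition covering_number :: "'a::metric_space set \<Rightarrow> real \<Rightarrow> nat" where
  "covering_number A \<rho> =
     Inf {card C | C. finite C \<and> A \<subseteq> \<Union>C \<and> (\<forall>U\<in>C. bounded U \<and> diameter U \<le> \<rho>)}"

definition upper_box_dim :: "'a::metric_space set \<Rightarrow> ereal" where
  "upper_box_dim A = Limsup (at_right 0) (\<lambda>\<rho>. ereal (ln (real (covering_number A \<rho>)) / - ln \<rho>))"


section \<open>Boxes\<close>

text \<open>
  The coordinates of \<open>real ^ 'n\<close> are indexed by an arbitrary finite linear order, so that
  \<open>Min UNIV\<close> is the first index. \<open>open_box l B\<close> means that \<open>B\<close> is an
  open box, in arbitrary position, whose decreasingly ordered side lengths are the entries of \<open>l\<close>.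
\<close>

definition open_box :: "real ^ 'n::{finite,linorder} \<Rightarrow> (real ^ 'n::{finite,linorder}) set \<Rightarrow> bool" where
  "open_box l B \<longleftrightarrow>
     (\<forall>i. 0 < l $ i) \<and> (\<forall>i j. i \<le> j \<longrightarrow> l $ j \<le> l $ i) \<and>
     (\<exists>f c. orthogonal_transformation f \<and>
        B = (\<lambda>x. c + f x) ` {x. \<forall>i. 0 < x $ i \<and> x $ i < l $ i})"

definition nonneg_exponents :: "(real ^ 'n) set" where
  "nonneg_exponents = {\<alpha>. \<forall>i. 0 \<le> \<alpha> $ i}"

definition vec_powr :: "real ^ 'n \<Rightarrow> real ^ 'n \<Rightarrow> real" where
  "vec_powr l \<alpha> = (\<Prod>i\<in>UNIV. (l $ i) powr (\<alpha> $ i))"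


section \<open>Dimension prints\<close>

definition scales :: "(real ^ 'n::{finite,linorder}) set" where
  "scales = {\<delta>. (\<forall>i. 0 < \<delta> $ i \<and> \<delta> $ i < 1) \<and> (\<forall>i j. i \<le> j \<longrightarrow> \<delta> $ j \<le> \<delta> $ i)}"

definition box_covering_number :: "(real ^ 'n::{finite,linorder}) set \<Rightarrow> real ^ 'n::{finite,linorder} \<Rightarrow> nat" where
  "box_covering_number F \<delta> =
     Inf {card C | C. finite C \<and> F \<subseteq> \<Union>C \<and> (\<forall>B\<in>C. \<exists>l. open_box l B \<and> (\<forall>i. l $ i \<le> \<delta> $ i))}"

text \<open>All scale vectors, with only their first (largest) entry required to tend to 0.\<close>

definition scales_to_zero :: "(real ^ 'n::{finite,linorder}) filter" where
  "scales_to_zero = inf (filtercomap (\<lambda>\<delta>. \<delta> $ Min UNIV) (at_right 0)) (principal scales)"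

definition lower_box_print :: "(real ^ 'n::{finite,linorder}) set \<Rightarrow> (real ^ 'n::{finite,linorder}) set" where
  "lower_box_print F = {\<alpha> \<in> nonneg_exponents.
     Liminf scales_to_zero (\<lambda>\<delta>. ereal (real (box_covering_number F \<delta>) * vec_powr \<delta> \<alpha>)) > 0}"

text \<open>
  A cover is indexed by some \<open>J \<subseteq> \<nat>\<close>, which may be finite: boxes are never empty, so
  a finite cover cannot be padded to an infinite one for free (for instance if \<open>\<alpha> = 0\<close>).
\<close>

definition print_premeasure ::
    "real ^ 'n::{finite,linorder} \<Rightarrow> real \<Rightarrow> (real ^ 'n::{finite,linorder}) set \<Rightarrow> ennreal" where
  "print_premeasure \<alpha> \<eta> A =
     (INF (J, l, B) \<in> {(J :: nat set, l, B). A \<subseteq> (\<Union>j\<in>J. B j) \<and>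
                         (\<forall>j\<in>J. open_box (l j) (B j) \<and> diameter (B j) \<le> \<eta>)}.
        \<Sum>\<^sub>\<infinity>j\<in>J. ennreal (vec_powr (l j) \<alpha>))"

definition print_measure :: "real ^ 'n::{finite,linorder} \<Rightarrow> (real ^ 'n::{finite,linorder}) set \<Rightarrow> ennreal" where
  "print_measure \<alpha> A = Lim (at_right 0) (\<lambda>\<eta>. print_premeasure \<alpha> \<eta> A)"

lemma print_measure_eq_SUP: "print_measure \<alpha> A = (SUP \<eta>\<in>{0<..}. print_premeasure \<alpha> \<eta> A)"
  unfolding print_measure_def
proof (rule tendsto_Lim)
  have mono: "print_premeasure \<alpha> \<eta>' A \<le> print_premeasure \<alpha> \<eta> A" if "\<eta> \<le> \<eta>'" for \<eta> \<eta>'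
    unfolding print_premeasure_def using that
    by (intro INF_superset_mono) (fastforce intro: order_trans)+
  show "((\<lambda>\<eta>. print_premeasure \<alpha> \<eta> A) \<longlongrightarrow> (SUP \<eta>\<in>{0<..}. print_premeasure \<alpha> \<eta> A)) (at_right 0)"
  proof (rule order_tendstoI)
    fix y assume "y < (SUP \<eta>\<in>{0<..}. print_premeasure \<alpha> \<eta> A)"
    then obtain e where e: "e > 0" "y < print_premeasure \<alpha> e A" by (auto simp: less_SUP_iff)
    show "\<forall>\<^sub>F \<eta> in at_right 0. y < print_premeasure \<alpha> \<eta> A"
      unfolding eventually_at_right_field
    proof (intro exI[of _ e] conjI allI impI)
      fix \<eta> assume "\<eta> < e"
      thus "y < print_premeasure \<alpha> \<eta> A" using e(2) mono[of \<eta> e] by (simp add: less_le_trans)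
    qed (fact e(1))
  next
    fix y assume "(SUP \<eta>\<in>{0<..}. print_premeasure \<alpha> \<eta> A) < y"
    hence "print_premeasure \<alpha> \<eta> A < y" if "\<eta> > 0" for \<eta>
      using SUP_upper[of \<eta> "{0<..}" "\<lambda>\<eta>. print_premeasure \<alpha> \<eta> A"] that by simp
    thus "\<forall>\<^sub>F \<eta> in at_right 0. print_premeasure \<alpha> \<eta> A < y"
      unfolding eventually_at_right_field by (intro exI[of _ 1]) auto
  qed
qed simp

definition hausdorff_print :: "(real ^ 'n::{finite,linorder}) set \<Rightarrow> (real ^ 'n::{finite,linorder}) set" where
  "hausdorff_print A = {\<alpha> \<in> nonneg_exponents. print_measure \<alpha> A > 0}"


section \<open>Products of restricted Hausdorff measures\<close>

definition hausdorff_restrict :: "real \<Rightarrow> 'a::metric_space set \<Rightarrow> 'a measure" where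
  "hausdorff_restrict s E = density (hausdorff_measure s) (indicator E)"

text \<open>\<open>PiM\<close> lives on functions; it is transported to \<open>real ^ 'n\<close>.\<close>

definition hausdorff_product :: "real ^ 'n \<Rightarrow> ('n::finite \<Rightarrow> real set) \<Rightarrow> (real ^ 'n) measure" where
  "hausdorff_product s E =
     distr (\<Pi>\<^sub>M i\<in>UNIV. hausdorff_restrict (s $ i) (E i)) borel (\<lambda>x. \<chi> i. x i)"

lemma emeasure_hausdorff_restrict:
  assumes "E \<in> sets borel" "A \<in> sets borel"
  shows "emeasure (hausdorff_restrict s E) A = hausdorff_outer s (E \<inter> A)"
  using assms unfolding hausdorff_restrict_def
  by (simp add: emeasure_restricted emeasure_hausdorff_measure sets.Int)

lemma emeasure_hausdorff_product:
  fixes s :: "real ^ 'n::finite"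
  assumes E: "\<And>i. E i \<in> sets borel" "\<And>i. hausdorff_outer (s $ i) (E i) < \<infinity>"
    and A: "\<And>i. A i \<in> sets borel"
  shows "emeasure (hausdorff_product s E) {x. \<forall>i. x $ i \<in> A i} =
           (\<Prod>i\<in>UNIV. hausdorff_outer (s $ i) (E i \<inter> A i))"
proof -
  let ?M = "\<lambda>i. hausdorff_restrict (s $ i) (E i)"
  have sets_M [simp, measurable_cong]: "sets (?M i) = sets borel" for i
    by (simp add: hausdorff_restrict_def)
  have space_M [simp]: "space (?M i) = UNIV" for i
    by (simp add: hausdorff_restrict_def)
  have fin: "finite_measure (?M i)" for i
    using E[of i] by (intro finite_measureI) (simp add: emeasure_hausdorff_restrict)
  interpret product_sigma_finite ?M
    unfolding product_sigma_finite_def using fin finite_measure.axioms(1) by blast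
  have meas: "(\<lambda>x. \<chi> i. x i) \<in> Pi\<^sub>M UNIV ?M \<rightarrow>\<^sub>M borel"
  proof (subst borel_measurable_euclidean_space, safe)
    fix b :: "real ^ 'n" assume "b \<in> Basis"
    then obtain k where b: "b = axis k 1" by (auto simp: Basis_vec_def)
    have "(\<lambda>x. x k) \<in> Pi\<^sub>M UNIV ?M \<rightarrow>\<^sub>M ?M k" by (rule measurable_component_singleton) simp
    hence "(\<lambda>x. x k) \<in> Pi\<^sub>M UNIV ?M \<rightarrow>\<^sub>M borel" by (simp cong: measurable_cong_sets)
    thus "(\<lambda>x. (\<chi> i. x i) \<bullet> b) \<in> borel_measurable (Pi\<^sub>M UNIV ?M)" by (simp add: b inner_axis)
  qed
  have "(\<lambda>x :: real ^ 'n. x $ i) -` A i \<in> sets borel" for i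
    using measurable_sets[OF borel_measurable_continuous_onI[OF continuous_on_component[OF continuous_on_id]] A[of i]]
    by simp
  hence "(\<Inter>i. (\<lambda>x :: real ^ 'n. x $ i) -` A i) \<in> sets borel" by (intro sets.finite_INT) auto
  moreover have "(\<Inter>i. (\<lambda>x :: real ^ 'n. x $ i) -` A i) = {x. \<forall>i. x $ i \<in> A i}" by auto
  ultimately have "emeasure (hausdorff_product s E) {x. \<forall>i. x $ i \<in> A i} =
      emeasure (Pi\<^sub>M UNIV ?M) (Pi\<^sub>E UNIV A)"
    unfolding hausdorff_product_def
    by (subst emeasure_distr[OF meas]) (auto simp: space_PiM PiE_UNIV_domain intro!: arg_cong2[where f = emeasure])
  also have "\<dots> = (\<Prod>i\<in>UNIV. emeasure (?M i) (A i))"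
    using A by (intro emeasure_PiM) auto
  finally show ?thesis using E A by (simp add: emeasure_hausdorff_restrict)
qed

end

theory Submission
  imports Defs
begin

text \<open>
  Write \<open>T\<close> for the set of exponents whose tail sums are bounded by those of \<open>s\<close>. The theorem
  follows from a cycle of inclusions: \<open>T\<close> lies in the Hausdorff print, which lies in the lower box
  print, which lies in \<open>T\<close>.

  For \<open>T\<close> inside the Hausdorff print (\<open>print_measure_pos\<close>) the mass distribution principle is applied
  to the product measure \<open>\<nu>\<close>, so the point is to bound the mass of a box in arbitrary position by
  a constant times its weight \<open>vec_powr l \<alpha>\<close>. Each set \<open>E i\<close> can be thinned, with an arbitrarily small
  loss of mass, to a set on which the Hausdorff measure has a Frostman bound \<open>K * r powr s i\<close> for balls
  of every radius (\<open>frostman_subset\<close>); the remaining part of \<open>F\<close> still has positive mass. A rotated box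
  is then measured by slicing. Gaussian elimination on its edge directions, starting with the thinnest,
  assigns to the edges \<open>j\<close> pairwise distinct coordinates \<open>\<sigma> j\<close> such that, once the coordinates of the
  longer edges are fixed, the coordinate \<open>\<sigma> j\<close> is confined to an interval of length at most a constant
  times \<open>l j\<close> (\<open>orthonormal_pivots\<close>). Fubini bounds the mass by a constant times
  \<open>\<Prod>j. l j powr s (\<sigma> j)\<close> (\<open>emeasure_PiM_le_prod\<close>). As \<open>s\<close> is decreasing, the tail sums of
  \<open>s \<circ> \<sigma>\<close> are at least those of \<open>s\<close>, hence at least those of \<open>\<alpha>\<close>, and summation by parts bounds this
  product by \<open>vec_powr l \<alpha>\<close> for decreasing side lengths at most 1. This is where the
  orderings of both \<open>s\<close> and the side lengths enter.

  The second inclusion (\<open>hausdorff_print_subset_lower_box_print\<close>) holds because a cover that is optimal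
  for \<open>N(F; \<delta>)\<close> is a competitor in the definition of the premeasure, of total weight at most
  \<open>N(F; \<delta>)\<close> times \<open>vec_powr \<delta> \<alpha>\<close>.

  For the third (\<open>lower_box_print_tail_sums\<close>), products of covers of the sets \<open>E i\<close> bound \<open>N(F; \<delta>)\<close> by
  a constant times \<open>\<Prod>i. \<delta> i powr - (s i + \<epsilon>)\<close>. If the tail sum of \<open>\<alpha>\<close> from \<open>k\<close> on exceeds that
  of \<open>s\<close>, take \<open>\<delta> i = t\<close> for \<open>i < k\<close> and \<open>\<delta> i = t powr m\<close> for \<open>i \<ge> k\<close>: for large \<open>m\<close> the positive
  exponent of the tail dominates, and \<open>N(F; \<delta>)\<close> times \<open>vec_powr \<delta> \<alpha>\<close> tends to 0 with \<open>t\<close>.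
\<close>

section \<open>Large Frostman subsets of sets of finite Hausdorff measure\<close>

lemma ennreal_pos_real_below:
  assumes "0 < (x :: ennreal)"
  obtains c where "0 < c" "ennreal c < x"
proof -
  obtain z where "0 < z" "z < x" using dense[OF assms] by blast
  thus thesis using that[of "enn2real z"] by (cases z) auto
qed

text \<open>
  The points removed are those lying in a small ball \<open>ball a r\<close> of mass above \<open>M * r powr s\<close>. A disjoint
  Vitali subfamily of such balls, enlarged five times, covers these points, with total gauge at most
  \<open>10 powr s / M\<close> times the mass of \<open>E\<close>; so the points that are bad at every scale form a set of small
  measure if \<open>M\<close> is large. Continuity from above makes the points that are bad at one fixed scale almost
  as rare, and removing these leaves a bound that is uniform in the centre. Balls of larger
  radius obey it after enlarging the constant, as \<open>E\<close> has finite measure.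
\<close>

lemma frostman_subset:
  fixes E :: "'a::euclidean_space set"
  assumes E: "E \<in> sets borel" and fin: "hausdorff_outer s E < \<infinity>" and s: "0 \<le> s" and e: "0 < (e::ennreal)"
  obtains D K where "D \<in> sets borel" "D \<subseteq> E" "0 \<le> K" "hausdorff_outer s (E - D) < e"
    "\<And>y r. 0 < r \<Longrightarrow> hausdorff_outer s (D \<inter> cball y r) \<le> ennreal (K * r powr s)"
proof -
  let ?H = "hausdorff_outer s :: 'a set \<Rightarrow> ennreal"
  define \<mu> where "\<mu> = hausdorff_restrict s E"
  have sets_\<mu>: "sets \<mu> = sets borel" by (simp add: \<mu>_def hausdorff_restrict_def)
  have em: "emeasure \<mu> A = ?H (E \<inter> A)" if "A \<in> sets borel" for A
    using that E by (simp add: \<mu>_def emeasure_hausdorff_restrict)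
  obtain h where h: "0 \<le> h" "?H E = ennreal h" using fin by (cases "?H E") auto
  obtain \<epsilon> where \<epsilon>: "0 < \<epsilon>" "ennreal \<epsilon> < e" using ennreal_pos_real_below[OF e] .
  \<comment> \<open>With this \<open>M\<close> the bad part has measure at most \<open>\<epsilon> * h / (h + 1)\<close>; adding 1 keeps \<open>M\<close> positive when \<open>h = 0\<close>.\<close>
  define M where "M = 10 powr s * (h + 1) / \<epsilon>"
  have M: "0 < M" using h \<epsilon> by (simp add: M_def)
  define bad where "bad k = {p :: 'a \<times> real. 0 < snd p \<and> snd p < 1 / (real k + 1)
      \<and> ennreal (M * snd p powr s) < ?H (E \<inter> ball (fst p) (snd p))}" for k :: nat
  define A where "A k = E \<inter> (\<Union>p\<in>bad k. ball (fst p) (snd p))" for k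
  have A_borel: "A k \<in> sets borel" for k unfolding A_def by (intro sets.Int E borel_open open_UN) auto
  have bad_anti: "bad k \<subseteq> bad j" if "j \<le> k" for j k
  proof -
    have "1 / (real k + 1) \<le> 1 / (real j + 1)" using that by (simp add: frac_le)
    thus ?thesis unfolding bad_def by auto
  qed
  have A_anti: "A k \<subseteq> A j" if "j \<le> k" for j k
    using bad_anti[OF that] unfolding A_def by blast
  have content: "hausdorff_content s (10 / (real k + 1)) (A k) \<le> ennreal (\<epsilon> * h / (h + 1))" for k
  proof -
    obtain C where C: "countable C" "C \<subseteq> bad k"
      "pairwise (\<lambda>i j. disjnt (ball (fst i) (snd i)) (ball (fst j) (snd j))) C"
      "A k \<subseteq> (\<Union>i\<in>C. ball (fst i) (5 * snd i))"
    proof (rule Vitali_covering_lemma_balls[where S = "A k" and K = "bad k" and a = fst and r = snd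
            and B = "1 / (real k + 1)"])
      show "A k \<subseteq> (\<Union>i\<in>bad k. ball (fst i) (snd i))" by (auto simp: A_def)
    qed (auto simp: bad_def)
    define g where "g = to_nat_on C"
    have g: "inj_on g C" unfolding g_def using C(1) by (rule inj_on_to_nat_on)
    define c where "c n = inv_into C g n" for n
    have c: "c n \<in> C" if "n \<in> g ` C" for n using that by (simp add: c_def inv_into_into)
    have gc: "g (c n) = n" if "n \<in> g ` C" for n using that by (simp add: c_def f_inv_into_f)
    define U where "U n = (if n \<in> g ` C then ball (fst (c n)) (5 * snd (c n)) else {})" for n
    define V where "V n = (if n \<in> g ` C then ball (fst (c n)) (snd (c n)) else {})" for n
    have V_borel: "V n \<in> sets borel" for n by (auto simp: V_def)
    have "hausdorff_content s (10 / (real k + 1)) (A k) \<le> (\<Sum>n. ennreal (hausdorff_gauge s (U n)))"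
    proof (rule hausdorff_content_le)
      show "A k \<subseteq> (\<Union>n. U n)"
      proof
        fix x assume "x \<in> A k"
        then obtain i where i: "i \<in> C" "x \<in> ball (fst i) (5 * snd i)" using C(4) by blast
        hence "x \<in> U (g i)" using g by (simp add: U_def c_def)
        thus "x \<in> (\<Union>n. U n)" by blast
      qed
      show "bounded (U n)" for n by (simp add: U_def)
      show "diameter (U n) \<le> 10 / (real k + 1)" for n
        using c[of n] C(2) by (auto simp: U_def bad_def field_simps)
    qed
    also have "\<dots> \<le> (\<Sum>n. ennreal (10 powr s / M) * emeasure \<mu> (V n))"
    proof (intro suminf_le)
      fix n
      show "ennreal (hausdorff_gauge s (U n)) \<le> ennreal (10 powr s / M) * emeasure \<mu> (V n)"
      proof (cases "n \<in> g ` C")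
        case True
        define a r where "a = fst (c n)" and "r = snd (c n)"
        have ar: "0 < r" "ennreal (M * r powr s) < ?H (E \<inter> ball a r)"
          using c[OF True] C(2) by (auto simp: bad_def a_def r_def)
        have "hausdorff_gauge s (U n) = (10 * r) powr s"
          using True ar(1) by (auto simp: hausdorff_gauge_def U_def a_def r_def)
        also have "\<dots> = 10 powr s / M * (M * r powr s)"
          using M ar(1) by (simp add: powr_mult)
        finally have "ennreal (hausdorff_gauge s (U n)) = ennreal (10 powr s / M) * ennreal (M * r powr s)"
          using M by (subst ennreal_mult[symmetric]) auto
        also have "\<dots> \<le> ennreal (10 powr s / M) * emeasure \<mu> (V n)"
          using ar(2) True by (intro mult_left_mono) (auto simp: V_def em a_def r_def)
        finally show ?thesis .
      qed (simp add: U_def hausdorff_gauge_def)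
    qed auto
    also have "\<dots> = ennreal (10 powr s / M) * (\<Sum>n. emeasure \<mu> (V n))"
      by (rule ennreal_suminf_cmult)
    also have "(\<Sum>n. emeasure \<mu> (V n)) = emeasure \<mu> (\<Union>n. V n)"
    proof (rule suminf_emeasure)
      show "range V \<subseteq> sets \<mu>" using V_borel sets_\<mu> by auto
      show "disjoint_family V"
        unfolding disjoint_family_on_def
      proof (intro ballI impI)
        fix m n :: nat assume "m \<noteq> n"
        show "V m \<inter> V n = {}"
        proof (cases "m \<in> g ` C \<and> n \<in> g ` C")
          case True
          hence "c m \<noteq> c n" using gc \<open>m \<noteq> n\<close> by metis
          thus ?thesis using C(3) c True by (auto simp: V_def pairwise_def disjnt_def)
        qed (auto simp: V_def)
      qed
    qed
    also have "emeasure \<mu> (\<Union>n. V n) \<le> ?H E"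
      using V_borel by (subst em) (auto intro!: hausdorff_outer_mono)
    hence "ennreal (10 powr s / M) * emeasure \<mu> (\<Union>n. V n) \<le> ennreal (10 powr s / M) * ennreal h"
      using h by (intro mult_left_mono) auto
    also have "\<dots> = ennreal (\<epsilon> * h / (h + 1))"
      using h \<epsilon> by (simp add: M_def mult.commute flip: ennreal_mult)
    finally show ?thesis .
  qed
  have outer_limit: "?H (\<Inter>k. A k) \<le> ennreal (\<epsilon> * h / (h + 1))"
    unfolding hausdorff_outer_def
  proof (rule SUP_least)
    fix \<eta> :: real assume "\<eta> \<in> {0<..}"
    then obtain k where "inverse (real (Suc k)) < \<eta> / 10"
      using reals_Archimedean[of "\<eta> / 10"] by auto
    hence k: "10 / (real k + 1) \<le> \<eta>" by (simp add: field_simps)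
    have "hausdorff_content s \<eta> (\<Inter>k. A k) \<le> hausdorff_content s (10 / (real k + 1)) (A k)"
      using hausdorff_content_antimono[OF k] hausdorff_content_mono[of "\<Inter>k. A k" "A k"]
      by (meson INT_lower UNIV_I order_trans)
    also note content
    finally show "hausdorff_content s \<eta> (\<Inter>k. A k) \<le> ennreal (\<epsilon> * h / (h + 1))" .
  qed
  have small: "ennreal (\<epsilon> * h / (h + 1)) < e"
  proof -
    have "\<epsilon> * h / (h + 1) \<le> \<epsilon>" using h \<epsilon> by (simp add: field_simps)
    thus ?thesis using \<epsilon>(2) ennreal_leI le_less_trans by blast
  qed
  have "E \<inter> (\<Inter>k. A k) = (\<Inter>k. A k)" by (auto simp: A_def)
  hence lim_small: "emeasure \<mu> (\<Inter>k. A k) < e"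
    using le_less_trans[OF outer_limit small] A_borel by (simp add: em)
  have "(\<lambda>k. emeasure \<mu> (A k)) \<longlonglongrightarrow> emeasure \<mu> (\<Inter>k. A k)"
  proof (rule Lim_emeasure_decseq)
    show "decseq A" using A_anti by (auto simp: decseq_def)
    show "emeasure \<mu> (A k) \<noteq> \<infinity>" for k
      using fin hausdorff_outer_mono[of "E \<inter> A k" E s] A_borel[of k]
      by (auto simp: em top_unique)
  qed (use A_borel sets_\<mu> in auto)
  from order_tendstoD(2)[OF this lim_small] obtain k where k: "emeasure \<mu> (A k) < e"
    by (auto simp: eventually_sequentially)
  define \<delta> where "\<delta> = 1 / (real k + 1)"
  have \<delta>: "0 < \<delta>" by (simp add: \<delta>_def)
  define K where "K = 2 powr s * (M + h / \<delta> powr s)"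
  show thesis
  proof (rule that[of "E - A k" K])
    show "E - A k \<in> sets borel" using E A_borel by blast
    show "E - A k \<subseteq> E" by blast
    show "0 \<le> K" using M h by (simp add: K_def)
    have "E - (E - A k) = E \<inter> A k" by blast
    thus "?H (E - (E - A k)) < e" using k A_borel by (simp add: em)
  next
    fix y :: 'a and r :: real assume r: "0 < r"
    show "?H ((E - A k) \<inter> cball y r) \<le> ennreal (K * r powr s)"
    proof (cases "(E - A k) \<inter> cball y r = {}")
      case False
      then obtain x where x: "x \<in> E" "x \<notin> A k" "dist y x \<le> r" by auto
      have K: "K * r powr s = M * (2 * r) powr s + h * ((2 * r) powr s / \<delta> powr s)"
        using r by (simp add: K_def powr_mult algebra_simps)
      show ?thesis
      proof (cases "2 * r < \<delta>")
        case True
        \<comment> \<open>Badness concerns all balls containing \<open>x\<close>, so the centre \<open>y\<close> need not lie in \<open>E\<close>.\<close>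
        have "x \<in> ball y (2 * r)" using x r by simp
        hence "(y, 2 * r) \<notin> bad k" using x unfolding A_def by fastforce
        hence "?H (E \<inter> ball y (2 * r)) \<le> ennreal (M * (2 * r) powr s)"
          using True r by (auto simp: bad_def \<delta>_def)
        moreover have "?H ((E - A k) \<inter> cball y r) \<le> ?H (E \<inter> ball y (2 * r))"
          using r by (intro hausdorff_outer_mono) auto
        moreover have "M * (2 * r) powr s \<le> K * r powr s" using K h by simp
        ultimately show ?thesis by (meson ennreal_leI order_trans)
      next
        case False
        have "\<delta> powr s \<le> (2 * r) powr s" using False \<delta> s by (intro powr_mono2) auto
        hence "1 \<le> (2 * r) powr s / \<delta> powr s" using \<delta> by simp
        hence "h * 1 \<le> h * ((2 * r) powr s / \<delta> powr s)" using h by (intro mult_left_mono) auto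
        hence "h \<le> K * r powr s" using K M by (simp add: add_increasing)
        moreover have "?H ((E - A k) \<inter> cball y r) \<le> ?H E" by (intro hausdorff_outer_mono) auto
        ultimately show ?thesis using h by (metis ennreal_leI order_trans)
      qed
    qed simp
  qed
qed

section \<open>Product measures of sets with thin slices\<close>

text \<open>
  Iterated Fubini. The slice condition compares two points of \<open>S\<close> and mentions no
  projections of \<open>S\<close>, whose measurability would be in doubt; it is inherited by the
  slices of \<open>S\<close> at fixed values of the first coordinate, which makes the induction work.
\<close>

lemma emeasure_PiM_le_prod:
  fixes M :: "'i \<Rightarrow> 'b::real_normed_vector measure"
  assumes "product_sigma_finite M" "distinct xs" "S \<in> sets (Pi\<^sub>M (set xs) M)"
    and "\<And>i. D i \<in> sets (M i)" "\<And>i y. cball y (r i) \<in> sets (M i)"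
    and "\<And>x i. x \<in> S \<Longrightarrow> i \<in> set xs \<Longrightarrow> x i \<in> D i"
    and "\<And>as i bs x y. xs = as @ i # bs \<Longrightarrow> x \<in> S \<Longrightarrow> y \<in> S \<Longrightarrow> (\<And>k. k \<in> set as \<Longrightarrow> x k = y k)
            \<Longrightarrow> dist (x i) (y i) \<le> r i"
    and "\<And>i y. emeasure (M i) (D i \<inter> cball y (r i)) \<le> b i"
  shows "emeasure (Pi\<^sub>M (set xs) M) S \<le> (\<Prod>i\<in>set xs. b i)"
  using assms(2,3,6,7)
proof (induction xs arbitrary: S)
  case Nil
  hence "S \<subseteq> {\<lambda>_. undefined}" using sets.sets_into_space[of S "Pi\<^sub>M {} M"] by (simp add: space_PiM)
  hence "S = {} \<or> S = {\<lambda>_. undefined}" by blast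
  thus ?case by (auto simp: PiM_empty)
next
  case (Cons i xs)
  interpret product_sigma_finite M by fact
  show ?case
  proof (cases "S = {}")
    case False
    then obtain p where p: "p \<in> S" by blast
    let ?sl = "\<lambda>y. {x \<in> space (Pi\<^sub>M (set xs) M). x(i := y) \<in> S}"
    have i: "i \<notin> set xs" "distinct xs" using Cons.prems by auto
    have upd: "(\<lambda>x. x(i := y)) \<in> Pi\<^sub>M (set xs) M \<rightarrow>\<^sub>M Pi\<^sub>M (insert i (set xs)) M"
      if "y \<in> space (M i)" for y
      using that by (intro measurable_fun_upd[where J = "set xs"]) auto
    have sl: "?sl y \<in> sets (Pi\<^sub>M (set xs) M)" if "y \<in> space (M i)" for y
      using measurable_sets[OF upd[OF that], of S] Cons.prems(2)
      by (simp add: vimage_def Int_def conj_commute)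
    have slice: "emeasure (Pi\<^sub>M (set xs) M) (?sl y)
        \<le> (\<Prod>i\<in>set xs. b i) * indicator (D i \<inter> cball (p i) (r i)) y" if y: "y \<in> space (M i)" for y
    proof (cases "?sl y = {}")
      case False
      then obtain q where q: "q \<in> S" "q i = y" by fastforce
      have "dist (p i) y \<le> r i" using Cons.prems(4)[of "[]" i xs p q] p q by simp
      moreover have "y \<in> D i" using Cons.prems(3)[OF q(1), of i] q(2) by simp
      moreover have "emeasure (Pi\<^sub>M (set xs) M) (?sl y) \<le> (\<Prod>i\<in>set xs. b i)"
      proof (rule Cons.IH[OF i(2) sl[OF y]])
        fix x j assume x: "x \<in> ?sl y" "j \<in> set xs"
        define x' where "x' = x(i := y)"
        have "x' \<in> S" using x unfolding x'_def by blast
        hence "x' j \<in> D j" using x by (intro Cons.prems(3)) auto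
        moreover have "j \<noteq> i" using x i by auto
        ultimately show "x j \<in> D j" by (simp add: x'_def)
      next
        fix as j bs x z
        assume dec: "xs = as @ j # bs" and xz: "x \<in> ?sl y" "z \<in> ?sl y"
          and eq: "\<And>k. k \<in> set as \<Longrightarrow> x k = z k"
        define x' z' where "x' = x(i := y)" and "z' = z(i := y)"
        have "x' \<in> S" "z' \<in> S" using xz unfolding x'_def z'_def by blast+
        moreover have "x' k = z' k" if "k \<in> set (i # as)" for k
          using that eq by (auto simp: x'_def z'_def)
        ultimately have "dist (x' j) (z' j) \<le> r j"
          using Cons.prems(4)[of "i # as" j bs x' z'] dec by simp
        moreover have "j \<noteq> i" using dec i by auto
        ultimately show "dist (x j) (z j) \<le> r j" by (simp add: x'_def z'_def)
      qed
      ultimately show ?thesis by simp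
    next
      case True
      show ?thesis unfolding True by simp
    qed
    have "emeasure (Pi\<^sub>M (set (i # xs)) M) S = (\<integral>\<^sup>+ x. indicator S x \<partial>Pi\<^sub>M (insert i (set xs)) M)"
      using Cons.prems(2) by simp
    also have "\<dots> = (\<integral>\<^sup>+ y. \<integral>\<^sup>+ x. indicator S (x(i := y)) \<partial>Pi\<^sub>M (set xs) M \<partial>M i)"
      using i Cons.prems(2) by (intro product_nn_integral_insert_rev) auto
    also have "\<dots> = (\<integral>\<^sup>+ y. emeasure (Pi\<^sub>M (set xs) M) (?sl y) \<partial>M i)"
    proof (intro nn_integral_cong)
      fix y assume y: "y \<in> space (M i)"
      have "(\<integral>\<^sup>+ x. indicator S (x(i := y)) \<partial>Pi\<^sub>M (set xs) M) = (\<integral>\<^sup>+ x. indicator (?sl y) x \<partial>Pi\<^sub>M (set xs) M)"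
        by (intro nn_integral_cong) (auto simp: indicator_def)
      thus "(\<integral>\<^sup>+ x. indicator S (x(i := y)) \<partial>Pi\<^sub>M (set xs) M) = emeasure (Pi\<^sub>M (set xs) M) (?sl y)"
        using sl[OF y] by simp
    qed
    also have "\<dots> \<le> (\<integral>\<^sup>+ y. (\<Prod>i\<in>set xs. b i) * indicator (D i \<inter> cball (p i) (r i)) y \<partial>M i)"
      by (intro nn_integral_mono slice)
    also have "\<dots> = (\<Prod>i\<in>set xs. b i) * emeasure (M i) (D i \<inter> cball (p i) (r i))"
      using assms(4,5) by (intro nn_integral_cmult_indicator sets.Int) auto
    also have "\<dots> \<le> (\<Prod>i\<in>set xs. b i) * b i"
      using assms(8) by (intro mult_left_mono) auto
    finally show ?thesis using i by (simp add: mult.commute)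
  qed simp
qed

section \<open>Tail sums and monomials in the side lengths\<close>

text \<open>
  Summation by parts. The factor \<open>c\<close>, instead of 0, is what the induction needs: the step applies the
  induction hypothesis with the weight of the new smallest index in place of \<open>c\<close>.
\<close>

lemma weighted_sum_nonneg_of_tail_sums:
  fixes d L :: "'a::linorder \<Rightarrow> real"
  assumes "finite A" "\<And>i j. i \<in> A \<Longrightarrow> j \<in> A \<Longrightarrow> i \<le> j \<Longrightarrow> L i \<le> L j"
    and "\<And>k. k \<in> A \<Longrightarrow> 0 \<le> (\<Sum>i\<in>{i\<in>A. k \<le> i}. d i)"
    and "0 \<le> c" "\<And>i. i \<in> A \<Longrightarrow> c \<le> L i"
  shows "c * (\<Sum>i\<in>A. d i) \<le> (\<Sum>i\<in>A. d i * L i)"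
  using assms
proof (induction A arbitrary: c rule: finite_linorder_min_induct)
  case (insert b A)
  have b: "b \<notin> A" using insert by blast
  have tail: "{i \<in> insert b A. k \<le> i} = {i \<in> A. k \<le> i}" if "k \<in> A" for k
    using insert.hyps(2) that by auto
  have all: "{i \<in> insert b A. b \<le> i} = insert b A" using insert.hyps(2) by (auto intro: less_imp_le)
  have cb: "c \<le> L b" "0 \<le> L b" using insert.prems(3) insert.prems(4)[of b] by auto
  have "L b * (\<Sum>i\<in>A. d i) \<le> (\<Sum>i\<in>A. d i * L i)"
  proof (rule insert.IH)
    show "L i \<le> L j" if "i \<in> A" "j \<in> A" "i \<le> j" for i j using insert.prems(1) that by blast
    show "0 \<le> (\<Sum>i\<in>{i\<in>A. k \<le> i}. d i)" if "k \<in> A" for k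
      using insert.prems(2)[of k] that tail[OF that] by simp
    show "L b \<le> L i" if "i \<in> A" for i
      using insert.prems(1)[of b i] insert.hyps(2) that by (auto intro: less_imp_le)
  qed (fact cb)
  moreover have "c * (d b + (\<Sum>i\<in>A. d i)) \<le> L b * (d b + (\<Sum>i\<in>A. d i))"
    using insert.prems(2)[of b] all cb insert.hyps(1) b by (intro mult_right_mono) auto
  ultimately show ?case using insert.hyps(1) b by (simp add: algebra_simps)
qed simp

lemma prod_powr_mono_of_tail_sums:
  fixes l a b :: "'n::{finite,linorder} \<Rightarrow> real"
  assumes l: "\<And>i. 0 < l i" "\<And>i. l i \<le> 1" "\<And>i j. i \<le> j \<Longrightarrow> l j \<le> l i"
    and tail: "\<And>k. (\<Sum>i\<in>{k..}. a i) \<le> (\<Sum>i\<in>{k..}. b i)"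
  shows "(\<Prod>i\<in>UNIV. l i powr b i) \<le> (\<Prod>i\<in>UNIV. l i powr a i)"
proof -
  have "0 * (\<Sum>i\<in>UNIV. b i - a i) \<le> (\<Sum>i\<in>UNIV. (b i - a i) * (- ln (l i)))"
  proof (rule weighted_sum_nonneg_of_tail_sums)
    fix k :: 'n
    have "{i \<in> UNIV. k \<le> i} = {k..}" by auto
    thus "0 \<le> (\<Sum>i\<in>{i \<in> UNIV. k \<le> i}. b i - a i)"
      using tail[of k] by (simp add: sum_subtractf)
  qed (use l in auto)
  hence "(\<Sum>i\<in>UNIV. b i * ln (l i)) \<le> (\<Sum>i\<in>UNIV. a i * ln (l i))"
    by (simp add: algebra_simps sum.distrib sum_negf sum_subtractf)
  hence "exp (\<Sum>i\<in>UNIV. b i * ln (l i)) \<le> exp (\<Sum>i\<in>UNIV. a i * ln (l i))" by simp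
  moreover have "l i powr x = exp (x * ln (l i))" for i x using l(1)[of i] by (simp add: powr_def)
  ultimately show ?thesis by (simp add: exp_sum)
qed

text \<open>
  Outside their intersection, \<open>{k..}\<close> and its image have equally many elements; \<open>s\<close> is at most \<open>s k\<close>
  on those of the former and at least \<open>s k\<close> on those of the latter.
\<close>

lemma tail_sum_le_sum_image:
  fixes s :: "'n::{finite,linorder} \<Rightarrow> real"
  assumes "inj \<sigma>" "\<And>i j. i \<le> j \<Longrightarrow> s j \<le> s i"
  shows "(\<Sum>i\<in>{k..}. s i) \<le> (\<Sum>i\<in>{k..}. s (\<sigma> i))"
proof -
  let ?A = "{k..}" and ?B = "\<sigma> ` {k..}"
  have B: "(\<Sum>i\<in>?A. s (\<sigma> i)) = sum s ?B"
    using assms(1) by (subst sum.reindex) (auto intro: inj_on_subset)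
  have "card ?A = card ?B" using assms(1) by (simp add: card_image inj_on_subset)
  hence "card (?A - ?B) = card (?B - ?A)"
    by (simp add: card_Diff_subset_Int Int_commute)
  moreover have "sum s (?A - ?B) \<le> of_nat (card (?A - ?B)) * s k"
    using assms(2) by (intro sum_bounded_above) auto
  moreover have "of_nat (card (?B - ?A)) * s k \<le> sum s (?B - ?A)"
    using assms(2) by (intro sum_bounded_below) (auto intro: less_imp_le)
  ultimately have "sum s (?A - ?B) \<le> sum s (?B - ?A)" by simp
  moreover have "sum s ?A = sum s (?A - ?B) + sum s (?A \<inter> ?B)"
    by (subst sum.Int_Diff[of _ _ ?B]) (auto simp: add.commute)
  moreover have "sum s ?B = sum s (?B - ?A) + sum s (?A \<inter> ?B)"
    by (subst sum.Int_Diff[of _ _ ?A]) (auto simp: add.commute Int_commute)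
  ultimately show ?thesis unfolding B by simp
qed

section \<open>Pivot coordinates of a box\<close>

text \<open>
  Gaussian elimination with control of the constants. The list \<open>js\<close> runs from the thinnest slab
  \<open>\<bar>u j \<bullet> z\<bar> \<le> l j\<close> to the thickest. A multiple of the thinnest functional may be subtracted from
  all others at the price of a constant factor in their bounds, so a coordinate on which it is large
  can be eliminated from them. The lower bound on the distance from \<open>u j\<close> to the span of the
  other functionals survives this subtraction and keeps every later pivot away from 0. The set \<open>I\<close>
  holds the coordinates not yet eliminated.
\<close>

lemma pivot_coordinates:
  fixes js :: "'j list"
  assumes "distinct js"
  shows "\<exists>C>0. \<forall>(u :: 'j \<Rightarrow> real ^ 'n::finite) I l.
    card I = length js \<longrightarrow> sorted_wrt (\<lambda>a b. l a \<le> l b) js \<longrightarrow>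
    (\<forall>j\<in>set js. 0 \<le> l j \<and> (\<forall>i. \<bar>u j $ i\<bar> \<le> K) \<and> (\<forall>i. i \<notin> I \<longrightarrow> u j $ i = 0) \<and>
       (\<forall>v \<in> span (u ` (set js - {j})). 1 \<le> norm (u j + v))) \<longrightarrow>
    (\<exists>\<sigma>. bij_betw \<sigma> (set js) I \<and>
      (\<forall>z as j bs. (\<forall>j\<in>set js. \<bar>u j \<bullet> z\<bar> \<le> l j) \<longrightarrow> js = as @ j # bs \<longrightarrow>
        (\<forall>m\<in>set bs. z $ \<sigma> m = 0) \<longrightarrow> \<bar>z $ \<sigma> j\<bar> \<le> C * l j))"
  using assms
proof (induction js arbitrary: K)
  case Nil
  show ?case by (intro exI[of _ 1]) (auto simp: bij_betw_def)
next
  case (Cons j0 js)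
  define n where "n = real CARD('n)"
  have n: "0 < n" by (simp add: n_def)
  \<comment> \<open>Since \<open>\<bar>c j\<bar> \<le> \<bar>K\<bar> * n\<close> for the multipliers below, \<open>R\<close> bounds the factor by which a slab thickens in one step.\<close>
  define R where "R = 1 + \<bar>K\<bar> * n"
  have R: "0 < R" using n by (simp add: R_def add_pos_nonneg)
  from Cons.IH[of "\<bar>K\<bar> + \<bar>K\<bar> * n * \<bar>K\<bar>"] Cons.prems
  obtain C where "0 < C" and C: "\<And>(u :: 'j \<Rightarrow> real ^ 'n) I l. card I = length js \<Longrightarrow>
      sorted_wrt (\<lambda>a b. l a \<le> l b) js \<Longrightarrow>
    (\<And>j. j\<in>set js \<Longrightarrow> 0 \<le> l j \<and> (\<forall>i. \<bar>u j $ i\<bar> \<le> \<bar>K\<bar> + \<bar>K\<bar> * n * \<bar>K\<bar>) \<and> (\<forall>i. i \<notin> I \<longrightarrow> u j $ i = 0) \<and>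
       (\<forall>v \<in> span (u ` (set js - {j})). 1 \<le> norm (u j + v))) \<Longrightarrow>
    (\<exists>\<sigma>. bij_betw \<sigma> (set js) I \<and>
      (\<forall>z as j bs. (\<forall>j\<in>set js. \<bar>u j \<bullet> z\<bar> \<le> l j) \<longrightarrow> js = as @ j # bs \<longrightarrow>
        (\<forall>m\<in>set bs. z $ \<sigma> m = 0) \<longrightarrow> \<bar>z $ \<sigma> j\<bar> \<le> C * l j))"
    by auto
  define C' where "C' = max n (C * R)"
  have C': "0 < C'" "n \<le> C'" "C * R \<le> C'" using n by (simp_all add: C'_def)
  have step: "\<exists>\<sigma>. bij_betw \<sigma> (set (j0 # js)) I \<and>
      (\<forall>z as j bs. (\<forall>j\<in>set (j0 # js). \<bar>u j \<bullet> z\<bar> \<le> l j) \<longrightarrow> j0 # js = as @ j # bs \<longrightarrow>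
        (\<forall>m\<in>set bs. z $ \<sigma> m = 0) \<longrightarrow> \<bar>z $ \<sigma> j\<bar> \<le> C' * l j)"
    if card: "card I = length (j0 # js)" and sorted: "sorted_wrt (\<lambda>a b. l a \<le> l b) (j0 # js)"
      and u: "\<And>j. j\<in>set (j0 # js) \<Longrightarrow> 0 \<le> l j \<and> (\<forall>i. \<bar>u j $ i\<bar> \<le> K) \<and> (\<forall>i. i \<notin> I \<longrightarrow> u j $ i = 0) \<and>
       (\<forall>v \<in> span (u ` (set (j0 # js) - {j})). 1 \<le> norm (u j + v))"
    for u :: "'j \<Rightarrow> real ^ 'n" and I l
  proof -
    have "\<exists>i. 1 / n \<le> \<bar>u j0 $ i\<bar>"
    proof (rule ccontr)
      assume "\<not> ?thesis"
      hence "(\<Sum>i\<in>UNIV. \<bar>u j0 $ i\<bar>) < (\<Sum>i\<in>(UNIV::'n set). 1 / n)"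
        by (intro sum_strict_mono) (auto simp: not_le)
      hence "norm (u j0) < 1" using norm_le_l1_cart[of "u j0"] n by (simp add: n_def)
      moreover have "1 \<le> norm (u j0 + 0)" using u[of j0] span_zero by (metis list.set_intros(1))
      ultimately show False by simp
    qed
    then obtain i0 where i0: "1 / n \<le> \<bar>u j0 $ i0\<bar>" by blast
    have pos: "0 < \<bar>u j0 $ i0\<bar>" using i0 n by (meson less_le_trans zero_less_divide_1_iff)
    have i0I: "i0 \<in> I" using u[of j0] pos by auto
    have inv: "1 / \<bar>u j0 $ i0\<bar> \<le> n" using i0 n pos by (simp add: field_simps)
    define c where "c j = u j $ i0 / u j0 $ i0" for j
    define w where "w j = u j - c j *\<^sub>R u j0" for j
    have c: "\<bar>c j\<bar> \<le> \<bar>K\<bar> * n" if "j \<in> set js" for j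
    proof -
      have "\<bar>u j $ i0\<bar> \<le> \<bar>K\<bar>" using u[of j] that by (metis abs_ge_self list.set_intros(2) order_trans)
      hence "\<bar>u j $ i0\<bar> * (1 / \<bar>u j0 $ i0\<bar>) \<le> \<bar>K\<bar> * n" using inv by (intro mult_mono) auto
      thus ?thesis by (simp add: c_def abs_divide)
    qed
    have j0: "j0 \<notin> set js" using Cons.prems by simp
    have "\<exists>\<sigma>. bij_betw \<sigma> (set js) (I - {i0}) \<and>
      (\<forall>z as j bs. (\<forall>j\<in>set js. \<bar>w j \<bullet> z\<bar> \<le> R * l j) \<longrightarrow> js = as @ j # bs \<longrightarrow>
        (\<forall>m\<in>set bs. z $ \<sigma> m = 0) \<longrightarrow> \<bar>z $ \<sigma> j\<bar> \<le> C * (R * l j))"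
    proof (rule C)
      show "card (I - {i0}) = length js" using card i0I by simp
      show "sorted_wrt (\<lambda>a b. R * l a \<le> R * l b) js" using sorted R by (simp add: sorted_wrt_mono_rel)
    next
      fix j assume j: "j \<in> set js"
      show "0 \<le> R * l j \<and> (\<forall>i. \<bar>w j $ i\<bar> \<le> \<bar>K\<bar> + \<bar>K\<bar> * n * \<bar>K\<bar>) \<and> (\<forall>i. i \<notin> I - {i0} \<longrightarrow> w j $ i = 0) \<and>
       (\<forall>v \<in> span (w ` (set js - {j})). 1 \<le> norm (w j + v))"
      proof (intro conjI allI ballI impI)
        show "0 \<le> R * l j" using u[of j] R j by simp
      next
        fix i
        have "\<bar>u j $ i\<bar> \<le> \<bar>K\<bar>" "\<bar>u j0 $ i\<bar> \<le> \<bar>K\<bar>"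
          using u[of j] u[of j0] j by (metis abs_ge_self list.set_intros order_trans)+
        moreover have "\<bar>c j * u j0 $ i\<bar> \<le> \<bar>K\<bar> * n * \<bar>K\<bar>"
          unfolding abs_mult using c[OF j] calculation n by (intro mult_mono) auto
        ultimately show "\<bar>w j $ i\<bar> \<le> \<bar>K\<bar> + \<bar>K\<bar> * n * \<bar>K\<bar>"
          unfolding w_def vector_minus_component vector_scaleR_component real_scaleR_def by linarith
      next
        fix i assume "i \<notin> I - {i0}"
        thus "w j $ i = 0" using u[of j] u[of j0] j pos by (auto simp: w_def c_def)
      next
        fix v assume v: "v \<in> span (w ` (set js - {j}))"
        have in_span: "u m \<in> span (u ` (set (j0 # js) - {j}))" if "m \<in> set (j0 # js)" "m \<noteq> j" for m
          using that by (intro span_base) auto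
        have j0j: "j0 \<noteq> j" using j j0 by blast
        have "w ` (set js - {j}) \<subseteq> span (u ` (set (j0 # js) - {j}))"
          using in_span j0j by (auto simp: w_def intro!: span_diff span_scale)
        hence "v \<in> span (u ` (set (j0 # js) - {j}))" using v span_minimal subspace_span by blast
        hence "v - c j *\<^sub>R u j0 \<in> span (u ` (set (j0 # js) - {j}))"
          using in_span[of j0] j0j by (intro span_diff span_scale) auto
        hence "1 \<le> norm (u j + (v - c j *\<^sub>R u j0))" using u[of j] j by auto
        thus "1 \<le> norm (w j + v)" by (simp add: w_def algebra_simps)
      qed
    qed
    then obtain \<sigma> where \<sigma>: "bij_betw \<sigma> (set js) (I - {i0})"
      and tri: "\<And>z as j bs. (\<forall>j\<in>set js. \<bar>w j \<bullet> z\<bar> \<le> R * l j) \<Longrightarrow> js = as @ j # bs \<Longrightarrow>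
        (\<forall>m\<in>set bs. z $ \<sigma> m = 0) \<Longrightarrow> \<bar>z $ \<sigma> j\<bar> \<le> C * (R * l j)" by blast
    define \<tau> where "\<tau> = \<sigma>(j0 := i0)"
    have \<tau>_js: "\<tau> m = \<sigma> m" if "m \<in> set js" for m using that j0 by (auto simp: \<tau>_def)
    have "bij_betw \<tau> (set js) (I - {i0})" using \<sigma> \<tau>_js by (simp cong: bij_betw_cong)
    hence bij: "bij_betw \<tau> (set (j0 # js)) I"
      using i0I j0 notIn_Un_bij_betw[of j0 "set js" \<tau> "I - {i0}"]
      by (simp add: \<tau>_def insert_absorb)
    have "\<bar>z $ \<tau> j\<bar> \<le> C' * l j"
      if z: "\<forall>j\<in>set (j0 # js). \<bar>u j \<bullet> z\<bar> \<le> l j" and dec: "j0 # js = as @ j # bs"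
        and zero: "\<forall>m\<in>set bs. z $ \<tau> m = 0" for z as j bs
    proof (cases as)
      case Nil
      hence jj: "j = j0" "bs = js" using dec by auto
      have "z $ i = 0" if "i \<in> I" "i \<noteq> i0" for i
      proof -
        from \<sigma> that have "i \<in> \<sigma> ` set js" by (auto simp: bij_betw_def)
        thus ?thesis using zero \<tau>_js jj by auto
      qed
      hence summand: "u j0 $ i * z $ i = (if i = i0 then u j0 $ i0 * z $ i0 else 0)" for i
        using u[of j0] by (cases "i \<in> I") auto
      have "u j0 \<bullet> z = (\<Sum>i\<in>UNIV. u j0 $ i * z $ i)" by (simp add: inner_vec_def)
      also have "\<dots> = (\<Sum>i\<in>UNIV. if i = i0 then u j0 $ i0 * z $ i0 else 0)"
        by (rule sum.cong[OF refl summand])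
      also have "\<dots> = u j0 $ i0 * z $ i0" by simp
      finally have "u j0 \<bullet> z = u j0 $ i0 * z $ i0" .
      hence "\<bar>u j0 $ i0\<bar> * \<bar>z $ i0\<bar> \<le> l j0" using z by (simp add: abs_mult)
      hence "\<bar>z $ i0\<bar> \<le> l j0 * (1 / \<bar>u j0 $ i0\<bar>)" using pos by (simp add: field_simps)
      also have "\<dots> \<le> l j0 * n" using inv u[of j0] by (intro mult_left_mono) auto
      also have "\<dots> \<le> l j0 * C'" using u[of j0] C'(2) by (intro mult_left_mono) auto
      finally show ?thesis using jj by (simp add: \<tau>_def mult.commute)
    next
      case (Cons a as')
      hence js: "js = as' @ j # bs" using dec by simp
      have wz: "\<bar>w m \<bullet> z\<bar> \<le> R * l m" if m: "m \<in> set js" for m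
      proof -
        have l: "l j0 \<le> l m" using sorted m by simp
        have "\<bar>c m * (u j0 \<bullet> z)\<bar> \<le> \<bar>K\<bar> * n * l m"
          unfolding abs_mult using c[OF m] z l n by (intro mult_mono) (auto intro: order_trans)
        moreover have "\<bar>u m \<bullet> z\<bar> \<le> l m" using z m by simp
        moreover have "w m \<bullet> z = u m \<bullet> z - c m * (u j0 \<bullet> z)" by (simp add: w_def inner_diff_left)
        ultimately show ?thesis by (simp add: R_def algebra_simps)
      qed
      have "\<bar>z $ \<sigma> j\<bar> \<le> C * (R * l j)"
        using wz zero \<tau>_js js by (intro tri[of z as' j bs]) auto
      also have "\<dots> = C * R * l j" by simp
      also have "\<dots> \<le> C' * l j" using u[of j] js C'(3) by (intro mult_right_mono) auto
      finally show ?thesis using \<tau>_js[of j] js by simp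
    qed
    thus ?thesis using bij by blast
  qed
  show ?case
  proof (intro exI[of _ C'] conjI allI impI)
    fix u :: "'j \<Rightarrow> real ^ 'n" and I and l :: "'j \<Rightarrow> real"
    assume "card I = length (j0 # js)" "sorted_wrt (\<lambda>a b. l a \<le> l b) (j0 # js)"
      and "\<forall>j\<in>set (j0 # js). 0 \<le> l j \<and> (\<forall>i. \<bar>u j $ i\<bar> \<le> K) \<and> (\<forall>i. i \<notin> I \<longrightarrow> u j $ i = 0) \<and>
        (\<forall>v \<in> span (u ` (set (j0 # js) - {j})). 1 \<le> norm (u j + v))"
    thus "\<exists>\<sigma>. bij_betw \<sigma> (set (j0 # js)) I \<and>
      (\<forall>z as j bs. (\<forall>j\<in>set (j0 # js). \<bar>u j \<bullet> z\<bar> \<le> l j) \<longrightarrow> j0 # js = as @ j # bs \<longrightarrow>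
        (\<forall>m\<in>set bs. z $ \<sigma> m = 0) \<longrightarrow> \<bar>z $ \<sigma> j\<bar> \<le> C' * l j)"
      by (intro step) (assumption | erule (1) bspec)+
  qed (fact C'(1))
qed

text \<open>
  Each member of an orthonormal family has distance 1 from the span of the others, and its entries
  are bounded by 1, so the constant of the elimination depends on the dimension only.
\<close>

lemma orthonormal_pivots:
  "\<exists>C>0. \<forall>(u :: 'n::{finite,linorder} \<Rightarrow> real ^ 'n::{finite,linorder}) l.
      (\<forall>i j. u i \<bullet> u j = (if i = j then 1 else 0)) \<longrightarrow> (\<forall>i. 0 < l i) \<longrightarrow> (\<forall>i j. i \<le> j \<longrightarrow> l j \<le> l i) \<longrightarrow>
      (\<exists>\<sigma>. bij \<sigma> \<and> (\<forall>z j. (\<forall>j. \<bar>u j \<bullet> z\<bar> \<le> l j) \<longrightarrow> (\<forall>m<j. z $ \<sigma> m = 0) \<longrightarrow> \<bar>z $ \<sigma> j\<bar> \<le> C * l j))"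
proof -
  define js where "js = rev (sorted_list_of_set (UNIV :: 'n set))"
  have js: "distinct js" "set js = UNIV" "sorted_wrt (\<lambda>a b. b \<le> a) js"
    by (simp_all add: js_def sorted_wrt_rev)
  from pivot_coordinates[OF js(1), of 1] obtain C where C: "0 < C" and pivot:
    "\<forall>(u :: 'n \<Rightarrow> real ^ 'n::{finite,linorder}) I l.
    card I = length js \<longrightarrow> sorted_wrt (\<lambda>a b. l a \<le> l b) js \<longrightarrow>
    (\<forall>j\<in>set js. 0 \<le> l j \<and> (\<forall>i. \<bar>u j $ i\<bar> \<le> 1) \<and> (\<forall>i. i \<notin> I \<longrightarrow> u j $ i = 0) \<and>
       (\<forall>v \<in> span (u ` (set js - {j})). 1 \<le> norm (u j + v))) \<longrightarrow>
    (\<exists>\<sigma>. bij_betw \<sigma> (set js) I \<and>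
      (\<forall>z as j bs. (\<forall>j\<in>set js. \<bar>u j \<bullet> z\<bar> \<le> l j) \<longrightarrow> js = as @ j # bs \<longrightarrow>
        (\<forall>m\<in>set bs. z $ \<sigma> m = 0) \<longrightarrow> \<bar>z $ \<sigma> j\<bar> \<le> C * l j))" by blast
  have step: "\<exists>\<sigma>. bij \<sigma> \<and> (\<forall>z j. (\<forall>j. \<bar>u j \<bullet> z\<bar> \<le> l j) \<longrightarrow> (\<forall>m<j. z $ \<sigma> m = 0) \<longrightarrow> \<bar>z $ \<sigma> j\<bar> \<le> C * l j)"
    if u: "\<And>i j. u i \<bullet> u j = (if i = j then 1 else 0)" and l: "\<And>i. 0 < l i" "\<And>i j. i \<le> j \<Longrightarrow> l j \<le> l i"
    for u :: "'n \<Rightarrow> real ^ 'n::{finite,linorder}" and l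
  proof -
    have norm_u: "norm (u j) = 1" for j using u[of j j] by (simp add: norm_eq_sqrt_inner)
    have "1 \<le> norm (u j + v)" if v: "v \<in> span (u ` (set js - {j}))" for j v
    proof -
      have "orthogonal (u j) v" using v by (rule orthogonal_to_span) (auto simp: orthogonal_def u split: if_splits)
      hence "u j \<bullet> (u j + v) = 1" by (simp add: inner_add_right u orthogonal_def)
      thus ?thesis using norm_cauchy_schwarz[of "u j" "u j + v"] norm_u[of j] by simp
    qed
    moreover have "\<bar>u j $ i\<bar> \<le> 1" for i j using component_le_norm_cart[of "u j" i] norm_u by simp
    moreover have "card (UNIV :: 'n set) = length js" using distinct_card[OF js(1)] js(2) by simp
    moreover have "sorted_wrt (\<lambda>a b. l a \<le> l b) js"
      by (rule sorted_wrt_mono_rel[OF _ js(3)]) (use l in auto)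
    moreover have "0 \<le> l j" for j using l(1)[of j] by simp
    ultimately obtain \<sigma> where \<sigma>: "bij_betw \<sigma> (set js) UNIV" and
      tri: "\<forall>z as j bs. (\<forall>j\<in>set js. \<bar>u j \<bullet> z\<bar> \<le> l j) \<longrightarrow> js = as @ j # bs \<longrightarrow>
        (\<forall>m\<in>set bs. z $ \<sigma> m = 0) \<longrightarrow> \<bar>z $ \<sigma> j\<bar> \<le> C * l j"
      using pivot[rule_format, of UNIV l u] by auto
    have "\<bar>z $ \<sigma> j\<bar> \<le> C * l j" if z: "\<forall>j. \<bar>u j \<bullet> z\<bar> \<le> l j" "\<forall>m<j. z $ \<sigma> m = 0" for z j
    proof -
      obtain as bs where dec: "js = as @ j # bs" using split_list[of j js] js(2) by auto
      have "m < j" if "m \<in> set bs" for m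
        using js(1,3) that unfolding dec by (auto simp: sorted_wrt_append order.strict_iff_order)
      thus ?thesis using tri z dec by blast
    qed
    thus ?thesis using \<sigma> js(2) by auto
  qed
  show ?thesis by (intro exI[of _ C] conjI allI impI C step) auto
qed

section \<open>Geometry of open boxes\<close>

lemma open_box_slabs:
  assumes "open_box l B"
  obtains u c where "\<And>i j. u i \<bullet> u j = (if i = j then 1 else 0)"
    "B = {x. \<forall>j. 0 < u j \<bullet> (x - c) \<and> u j \<bullet> (x - c) < l $ j}"
proof -
  obtain f c where f: "orthogonal_transformation f"
    and B: "B = (\<lambda>x. c + f x) ` {x. \<forall>i. 0 < x $ i \<and> x $ i < l $ i}"
    using assms unfolding open_box_def by blast
  have inner: "f (axis j 1) \<bullet> f p = p $ j" for j p
    using f by (simp add: orthogonal_transformation_def inner_axis inner_commute)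
  have "B = {x. \<forall>j. 0 < f (axis j 1) \<bullet> (x - c) \<and> f (axis j 1) \<bullet> (x - c) < l $ j}" (is "_ = ?S")
  proof
    show "B \<subseteq> ?S" by (auto simp: B inner)
    show "?S \<subseteq> B"
    proof
      fix x assume x: "x \<in> ?S"
      obtain p where p: "x - c = f p" using orthogonal_transformation_surj[OF f] by (metis surjD)
      hence "x = c + f p" by (simp add: algebra_simps)
      moreover have "\<forall>j. 0 < p $ j \<and> p $ j < l $ j" using x by (simp add: p inner)
      ultimately show "x \<in> B" unfolding B by blast
    qed
  qed
  moreover have "f (axis i 1) \<bullet> f (axis j 1) = (if i = j then 1 else 0)" for i j
    unfolding inner by (simp add: axis_def)
  ultimately show thesis using that[of "\<lambda>j. f (axis j 1)" c] by blast
qed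

lemma open_open_box:
  assumes "open_box l B" shows "open B"
proof -
  obtain u c where "\<And>i j. u i \<bullet> u j = (if i = j then 1 else 0)"
    and "B = {x. \<forall>j. 0 < u j \<bullet> (x - c) \<and> u j \<bullet> (x - c) < l $ j}"
    by (rule open_box_slabs[OF assms]) (rule that)
  hence "B = (\<Inter>j. {x. 0 < u j \<bullet> (x - c)} \<inter> {x. u j \<bullet> (x - c) < l $ j})" by blast
  moreover have "open ({x. 0 < u j \<bullet> (x - c)} \<inter> {x. u j \<bullet> (x - c) < l $ j})" for j
    by (intro open_Int open_Collect_less continuous_intros)
  ultimately show ?thesis by (simp add: open_INT)
qed

lemma open_box_bounded_diameter:
  assumes "open_box l B"
  shows "bounded B" "diameter B \<le> (\<Sum>i\<in>UNIV. l $ i)"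
proof -
  obtain f c where f: "orthogonal_transformation f"
    and B: "B = (\<lambda>x. c + f x) ` {x. \<forall>i. 0 < x $ i \<and> x $ i < l $ i}"
    using assms unfolding open_box_def by blast
  have close: "norm (x - y) \<le> (\<Sum>i\<in>UNIV. l $ i)" if xy: "x \<in> B" "y \<in> B" for x y
  proof -
    obtain p q where pq: "x = c + f p" "y = c + f q"
      "\<forall>i. 0 < p $ i \<and> p $ i < l $ i" "\<forall>i. 0 < q $ i \<and> q $ i < l $ i"
      using xy unfolding B by blast
    have "norm (x - y) = norm (f (p - q))"
      using pq linear_diff[OF orthogonal_transformation_linear[OF f]] by simp
    also have "\<dots> = norm (p - q)" by (rule orthogonal_transformation_norm[OF f])
    also have "\<dots> \<le> (\<Sum>i\<in>UNIV. \<bar>(p - q) $ i\<bar>)" by (rule norm_le_l1_cart)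
    also have "\<dots> \<le> (\<Sum>i\<in>UNIV. l $ i)"
    proof (rule sum_mono)
      fix i show "\<bar>(p - q) $ i\<bar> \<le> l $ i" using spec[OF pq(3), of i] spec[OF pq(4), of i] by auto
    qed
    finally show ?thesis .
  qed
  show "bounded B"
  proof (cases "B = {}")
    case False
    then obtain x where "x \<in> B" by blast
    thus ?thesis using close[of x] unfolding bounded_def dist_norm by blast
  qed simp
  have "0 \<le> (\<Sum>i\<in>UNIV. l $ i)"
    using assms by (intro sum_nonneg) (auto simp: open_box_def intro: less_imp_le)
  thus "diameter B \<le> (\<Sum>i\<in>UNIV. l $ i)" using close by (intro diameter_le) auto
qed

lemma open_box_side_le_diameter:
  assumes "open_box l B" shows "l $ i \<le> 4 * diameter B"
proof -
  obtain u c where u: "\<And>i j. u i \<bullet> u j = (if i = j then 1 else 0)"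
    and B: "B = {x. \<forall>j. 0 < u j \<bullet> (x - c) \<and> u j \<bullet> (x - c) < l $ j}"
    by (rule open_box_slabs[OF assms]) (rule that)
  have l: "0 < l $ j" for j using assms by (simp add: open_box_def)
  define x where "x = c + (\<Sum>k\<in>UNIV. (l $ k / 2) *\<^sub>R u k)"
  define y where "y = x + (l $ i / 4) *\<^sub>R u i"
  have x: "u j \<bullet> (x - c) = l $ j / 2" for j
  proof -
    have "u j \<bullet> (x - c) = (\<Sum>k\<in>UNIV. l $ k / 2 * (u j \<bullet> u k))"
      by (simp add: x_def inner_sum_right)
    also have "\<dots> = (\<Sum>k\<in>UNIV. if k = j then l $ j / 2 else 0)"
      by (intro sum.cong) (auto simp: u)
    finally show ?thesis by simp
  qed
  have y: "u j \<bullet> (y - c) = u j \<bullet> (x - c) + l $ i / 4 * (u j \<bullet> u i)" for j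
    by (simp add: y_def inner_add_right inner_diff_right)
  have "0 < u j \<bullet> (x - c)" "u j \<bullet> (x - c) < l $ j"
      "0 < u j \<bullet> (y - c)" "u j \<bullet> (y - c) < l $ j" for j
    unfolding y x u using l[of j] by auto
  hence "x \<in> B" "y \<in> B" unfolding B by blast+
  hence "dist x y \<le> diameter B"
    using open_box_bounded_diameter(1)[OF assms] by (intro diameter_bounded_bound)
  moreover have "norm (u i) = 1" using u[of i i] by (simp add: norm_eq_sqrt_inner)
  ultimately show ?thesis using l[of i] by (simp add: y_def dist_norm)
qed

section \<open>The measure of a box\<close>

lemma borel_coordinatewise:
  fixes D :: "'n::finite \<Rightarrow> real set"
  assumes "\<And>i. D i \<in> sets borel"
  shows "{x :: real ^ 'n. \<forall>i. x $ i \<in> D i} \<in> sets borel"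
proof -
  have "(\<lambda>x :: real ^ 'n. x $ i) -` D i \<in> sets borel" for i
    using measurable_sets[OF borel_measurable_continuous_onI[OF continuous_on_component[OF continuous_on_id]] assms[of i]]
    by simp
  hence "(\<Inter>i. (\<lambda>x :: real ^ 'n. x $ i) -` D i) \<in> sets borel" by (intro sets.finite_INT) auto
  moreover have "(\<Inter>i. (\<lambda>x :: real ^ 'n. x $ i) -` D i) = {x. \<forall>i. x $ i \<in> D i}" by auto
  ultimately show ?thesis by simp
qed

lemma measurable_vec_lambda:
  fixes M :: "'n::finite \<Rightarrow> real measure"
  assumes "\<And>i. sets (M i) = sets borel"
  shows "(\<lambda>x. \<chi> i. x i) \<in> Pi\<^sub>M UNIV M \<rightarrow>\<^sub>M (borel :: (real ^ 'n) measure)"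
proof (subst borel_measurable_euclidean_space, safe)
  fix b :: "real ^ 'n" assume "b \<in> Basis"
  then obtain k where b: "b = axis k 1" by (auto simp: Basis_vec_def)
  have "(\<lambda>x. x k) \<in> Pi\<^sub>M UNIV M \<rightarrow>\<^sub>M M k" by (rule measurable_component_singleton) simp
  hence "(\<lambda>x. x k) \<in> Pi\<^sub>M UNIV M \<rightarrow>\<^sub>M borel" using assms by (simp cong: measurable_cong_sets)
  thus "(\<lambda>x. (\<chi> i. x i) \<bullet> b) \<in> borel_measurable (Pi\<^sub>M UNIV M)" by (simp add: b inner_axis)
qed

text \<open>
  The crucial estimate: the constant is uniform over all positions of the box. The difference of two points
  of the box lies in all the slabs \<open>\<bar>u j \<bullet> z\<bar> \<le> l j\<close>, so the pivot coordinates give the slice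
  condition with thickness \<open>C0 * l j\<close> for the coordinate \<open>\<sigma> j\<close>.
\<close>

lemma box_measure_le_vec_powr:
  fixes s :: "real ^ 'n::{finite,linorder}" and M :: "'n \<Rightarrow> real measure"
  assumes M: "product_sigma_finite M" "\<And>i. sets (M i) = sets borel"
    and D: "\<And>i. D i \<in> sets borel" and K: "0 < K"
    and frostman: "\<And>i y r. 0 < r \<Longrightarrow> emeasure (M i) (D i \<inter> cball y r) \<le> ennreal (K * r powr (s $ i))"
    and s: "\<And>i j. i \<le> j \<Longrightarrow> s $ j \<le> s $ i"
  obtains C where "0 < C"
    "\<And>l B \<alpha>. open_box l B \<Longrightarrow> (\<And>i. l $ i \<le> 1) \<Longrightarrow>
       (\<And>k. (\<Sum>i\<in>{k..}. \<alpha> $ i) \<le> (\<Sum>i\<in>{k..}. s $ i)) \<Longrightarrow>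
       emeasure (distr (Pi\<^sub>M UNIV M) borel (\<lambda>x. \<chi> i. x i)) (B \<inter> {x. \<forall>i. x $ i \<in> D i})
         \<le> ennreal (C * vec_powr l \<alpha>)"
proof -
  define ks where "ks = sorted_list_of_set (UNIV :: 'n set)"
  have ks: "distinct ks" "set ks = UNIV" "sorted ks" by (simp_all add: ks_def)
  obtain C0 where C0: "0 < C0" and pivot:
    "\<forall>(u :: 'n \<Rightarrow> real ^ 'n::{finite,linorder}) l.
      (\<forall>i j. u i \<bullet> u j = (if i = j then 1 else 0)) \<longrightarrow> (\<forall>i. 0 < l i) \<longrightarrow> (\<forall>i j. i \<le> j \<longrightarrow> l j \<le> l i) \<longrightarrow>
      (\<exists>\<sigma>. bij \<sigma> \<and> (\<forall>z j. (\<forall>j. \<bar>u j \<bullet> z\<bar> \<le> l j) \<longrightarrow> (\<forall>m<j. z $ \<sigma> m = 0) \<longrightarrow> \<bar>z $ \<sigma> j\<bar> \<le> C0 * l j))"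
    using orthonormal_pivots[where 'n = 'n] by blast
  define C where "C = (\<Prod>i\<in>UNIV. K * C0 powr (s $ i))"
  have C: "0 < C" using K C0 by (auto simp: C_def intro!: prod_pos mult_pos_pos)
  have "emeasure (distr (Pi\<^sub>M UNIV M) borel (\<lambda>x. \<chi> i. x i)) (B \<inter> {x. \<forall>i. x $ i \<in> D i})
         \<le> ennreal (C * vec_powr l \<alpha>)"
    if box: "open_box l B" and l1: "\<And>i. l $ i \<le> 1"
      and tail: "\<And>k. (\<Sum>i\<in>{k..}. \<alpha> $ i) \<le> (\<Sum>i\<in>{k..}. s $ i)" for l B \<alpha>
  proof -
    have l: "0 < l $ i" "i \<le> j \<Longrightarrow> l $ j \<le> l $ i" for i j using box by (auto simp: open_box_def)
    obtain u c where u: "\<And>i j. u i \<bullet> u j = (if i = j then 1 else 0)"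
      and B: "B = {x. \<forall>j. 0 < u j \<bullet> (x - c) \<and> u j \<bullet> (x - c) < l $ j}"
      by (rule open_box_slabs[OF box]) (rule that)
    obtain \<sigma> where \<sigma>: "bij \<sigma>" and tri: "\<And>z j. (\<forall>j. \<bar>u j \<bullet> z\<bar> \<le> l $ j) \<Longrightarrow>
        (\<forall>m<j. z $ \<sigma> m = 0) \<Longrightarrow> \<bar>z $ \<sigma> j\<bar> \<le> C0 * l $ j"
      using pivot[rule_format, of u "\<lambda>i. l $ i", OF u l] by blast
    define r where "r i = C0 * l $ inv \<sigma> i" for i
    have r: "0 < r i" for i using C0 l by (simp add: r_def)
    have r\<sigma>: "r (\<sigma> j) = C0 * l $ j" for j using \<sigma> by (simp add: r_def bij_is_inj)
    have set_xs: "set (map \<sigma> ks) = UNIV" using \<sigma> ks(2) by (simp add: bij_is_surj)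
    define S where "S = (\<lambda>x. \<chi> i. x i) -` (B \<inter> {x. \<forall>i. x $ i \<in> D i}) \<inter> space (Pi\<^sub>M UNIV M)"
    have borel: "B \<inter> {x. \<forall>i. x $ i \<in> D i} \<in> sets borel"
      using open_open_box[OF box] by (intro sets.Int borel_coordinatewise D) auto
    have "emeasure (Pi\<^sub>M (set (map \<sigma> ks)) M) S \<le> (\<Prod>i\<in>set (map \<sigma> ks). ennreal (K * r i powr (s $ i)))"
    proof (rule emeasure_PiM_le_prod[where D = D and r = r])
      show "distinct (map \<sigma> ks)"
        using ks(1) \<sigma> by (simp add: distinct_map bij_is_inj inj_on_subset[OF bij_is_inj])
      show "S \<in> sets (Pi\<^sub>M (set (map \<sigma> ks)) M)"
        unfolding S_def set_xs by (rule measurable_sets[OF measurable_vec_lambda borel]) (rule M)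
    next
      fix as i bs x y
      assume dec: "map \<sigma> ks = as @ i # bs" and xy: "x \<in> S" "y \<in> S"
        and eq: "\<And>k. k \<in> set as \<Longrightarrow> x k = y k"
      obtain as' j bs' where ks_dec: "ks = as' @ j # bs'" and as: "as = map \<sigma> as'" and i: "i = \<sigma> j"
        using dec by (auto simp: map_eq_append_conv map_eq_Cons_conv)
      define z :: "real ^ 'n::{finite,linorder}" where "z = (\<chi> i. x i) - (\<chi> i. y i)"
      have "\<bar>u j \<bullet> z\<bar> \<le> l $ j" for j
      proof -
        have "u j \<bullet> z = u j \<bullet> ((\<chi> i. x i) - c) - u j \<bullet> ((\<chi> i. y i) - c)"
          by (simp add: z_def inner_diff_right)
        moreover have "(\<chi> i. x i) \<in> B" "(\<chi> i. y i) \<in> B" using xy by (auto simp: S_def)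
        ultimately show ?thesis unfolding B by (smt (verit) mem_Collect_eq)
      qed
      moreover have "m \<in> set as'" if "m < j" for m
      proof -
        have "m \<notin> set bs'" using that ks(3) unfolding ks_dec by (auto simp: sorted_append)
        moreover have "m \<in> set as' \<or> m = j \<or> m \<in> set bs'" using ks(2) unfolding ks_dec by auto
        ultimately show ?thesis using that by blast
      qed
      hence "\<forall>m<j. z $ \<sigma> m = 0" using eq as by (simp add: z_def)
      ultimately have "\<bar>z $ \<sigma> j\<bar> \<le> C0 * l $ j" using tri by blast
      thus "dist (x i) (y i) \<le> r i" by (simp add: z_def dist_real_def i r\<sigma>)
    qed (use M D frostman r in \<open>auto simp: S_def\<close>)
    hence "emeasure (Pi\<^sub>M UNIV M) S \<le> (\<Prod>i\<in>UNIV. ennreal (K * r i powr (s $ i)))"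
      unfolding set_xs .
    also have "\<dots> = ennreal (\<Prod>i\<in>UNIV. K * r i powr (s $ i))" using K by (intro prod_ennreal) auto
    also have "(\<Prod>i\<in>UNIV. K * r i powr (s $ i)) = (\<Prod>j\<in>UNIV. K * r (\<sigma> j) powr (s $ \<sigma> j))"
      using \<sigma> by (intro prod.reindex_bij_betw[symmetric])
    also have "\<dots> = (\<Prod>j\<in>UNIV. K * C0 powr (s $ \<sigma> j)) * (\<Prod>j\<in>UNIV. l $ j powr (s $ \<sigma> j))"
      using C0 l by (simp add: r\<sigma> powr_mult less_imp_le mult.assoc flip: prod.distrib)
    also have "(\<Prod>j\<in>UNIV. K * C0 powr (s $ \<sigma> j)) = C"
      unfolding C_def using \<sigma> by (intro prod.reindex_bij_betw)
    also have "(\<Prod>j\<in>UNIV. l $ j powr (s $ \<sigma> j)) \<le> (\<Prod>j\<in>UNIV. l $ j powr (\<alpha> $ j))"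
    proof (rule prod_powr_mono_of_tail_sums)
      fix k
      note tail[of k]
      also have "(\<Sum>i\<in>{k..}. s $ i) \<le> (\<Sum>i\<in>{k..}. s $ \<sigma> i)"
        using \<sigma> s by (intro tail_sum_le_sum_image) (auto simp: bij_is_inj)
      finally show "(\<Sum>i\<in>{k..}. \<alpha> $ i) \<le> (\<Sum>i\<in>{k..}. s $ \<sigma> i)" .
    qed (use l l1 in auto)
    hence "ennreal (C * (\<Prod>j\<in>UNIV. l $ j powr (s $ \<sigma> j))) \<le> ennreal (C * vec_powr l \<alpha>)"
      using C by (intro ennreal_leI mult_left_mono) (auto simp: vec_powr_def)
    finally show ?thesis
      unfolding S_def using borel M(2) by (subst emeasure_distr[OF measurable_vec_lambda]) auto
  qed
  thus thesis using that C by blast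
qed

section \<open>Positivity of the print measure\<close>

lemma emeasure_UN_le_infsum:
  fixes g :: "nat \<Rightarrow> ennreal"
  assumes "\<And>j. j \<in> J \<Longrightarrow> B j \<in> sets M" "\<And>j. j \<in> J \<Longrightarrow> emeasure M (B j) \<le> c * g j"
  shows "emeasure M (\<Union>j\<in>J. B j) \<le> c * infsum g J"
proof -
  define f where "f j = (if j \<in> J then B j else {})" for j
  have "(\<Union>j\<in>J. B j) = (\<Union>j. f j)" by (auto simp: f_def split: if_splits)
  also have "emeasure M \<dots> \<le> (\<Sum>j. emeasure M (f j))"
    using assms(1) by (intro emeasure_subadditive_countably) (auto simp: f_def)
  also have "\<dots> \<le> c * infsum g J"
  proof (rule suminf_le_const)
    fix n
    have "(\<Sum>j<n. emeasure M (f j)) \<le> (\<Sum>j<n. if j \<in> J then c * g j else 0)"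
      using assms(2) by (intro sum_mono) (auto simp: f_def)
    also have "\<dots> = c * sum g ({..<n} \<inter> J)"
      by (simp add: sum.inter_restrict[symmetric] sum_distrib_left)
    also have "\<dots> \<le> c * infsum g J"
      by (intro mult_left_mono) (auto simp: nonneg_infsum_complete intro!: SUP_upper)
    finally show "(\<Sum>j<n. emeasure M (f j)) \<le> c * infsum g J" .
  qed simp
  finally show ?thesis .
qed

text \<open>
  Thinning the \<open>i\<close>-th factor by less than \<open>e\<close> costs a slab of mass at most \<open>e\<close> times the product
  of the masses of the other factors, and \<open>e\<close> can be chosen so small that all these slabs together have
  less mass than \<open>F\<close>.
\<close>

lemma hausdorff_product_frostman:
  fixes s :: "real ^ 'n::finite"
  assumes E: "\<And>i. E i \<in> sets borel" "\<And>i. hausdorff_outer (s $ i) (E i) < \<infinity>"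
    and s: "\<And>i. 0 \<le> s $ i" and F: "F \<in> sets borel" "F \<subseteq> {x. \<forall>i. x $ i \<in> E i}"
    and pos: "0 < emeasure (hausdorff_product s E) F"
  obtains D K where "\<And>i. D i \<in> sets borel" "0 < K"
    "\<And>i y r. 0 < r \<Longrightarrow> emeasure (hausdorff_restrict (s $ i) (E i)) (D i \<inter> cball y r) \<le> ennreal (K * r powr (s $ i))"
    "0 < emeasure (hausdorff_product s E) (F \<inter> {x. \<forall>i. x $ i \<in> D i})"
proof -
  let ?\<nu> = "hausdorff_product s E"
  have sets_\<nu>: "sets ?\<nu> = sets borel" by (simp add: hausdorff_product_def)
  define Q where "Q = (\<Sum>i\<in>UNIV. \<Prod>m\<in>UNIV - {i}. hausdorff_outer (s $ m) (E m))"
  have "hausdorff_outer (s $ i) (E i) \<noteq> top" for i using E(2)[of i] by simp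
  hence "Q < \<infinity>" by (simp add: Q_def ennreal_prod_eq_top less_top[symmetric])
  then obtain q where q: "0 \<le> q" "Q = ennreal q" by (cases Q) auto
  obtain p where p: "0 < p" "ennreal p < emeasure ?\<nu> F" using ennreal_pos_real_below[OF pos] .
  define e where "e = ennreal (p / (q + 1))"
  have e: "0 < e" using p q by (simp add: e_def)
  have "\<exists>D K. D \<in> sets borel \<and> D \<subseteq> E i \<and> 0 \<le> K \<and> hausdorff_outer (s $ i) (E i - D) < e \<and>
      (\<forall>y r. 0 < r \<longrightarrow> hausdorff_outer (s $ i) (D \<inter> cball y r) \<le> ennreal (K * r powr (s $ i)))" for i
    by (rule frostman_subset[OF E(1) E(2) s e, of i]) blast
  then obtain D K where D: "\<And>i. D i \<in> sets borel" "\<And>i. D i \<subseteq> E i" and K: "\<And>i. 0 \<le> K i"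
    and small: "\<And>i. hausdorff_outer (s $ i) (E i - D i) < e"
    and frostman: "\<And>i y r. 0 < r \<Longrightarrow> hausdorff_outer (s $ i) (D i \<inter> cball y r) \<le> ennreal (K i * r powr (s $ i))"
    by metis
  define G where "G = F \<inter> {x. \<forall>i. x $ i \<in> D i}"
  define N where "N i = {x :: real ^ 'n. \<forall>m. x $ m \<in> (if m = i then E i - D i else UNIV)}" for i
  have borel: "G \<in> sets borel" "N i \<in> sets borel" for i
    unfolding G_def N_def using F D E(1) by (auto intro!: borel_coordinatewise sets.Int)
  have N: "emeasure ?\<nu> (N i) \<le> e * (\<Prod>m\<in>UNIV - {i}. hausdorff_outer (s $ m) (E m))" for i
  proof -
    have "emeasure ?\<nu> (N i) = (\<Prod>m\<in>UNIV. hausdorff_outer (s $ m) (E m \<inter> (if m = i then E i - D i else UNIV)))"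
      unfolding N_def using E D by (intro emeasure_hausdorff_product) auto
    also have "\<dots> = hausdorff_outer (s $ i) (E i \<inter> (E i - D i)) * (\<Prod>m\<in>UNIV - {i}. hausdorff_outer (s $ m) (E m))"
      by (subst prod.remove[of _ i]) auto
    also have "E i \<inter> (E i - D i) = E i - D i" by blast
    finally show ?thesis using small[of i] by (simp add: mult_right_mono)
  qed
  have "0 < emeasure ?\<nu> G"
  proof (rule ccontr)
    assume "\<not> ?thesis"
    hence G0: "emeasure ?\<nu> G = 0" by simp
    have "F \<subseteq> G \<union> (\<Union>i. N i)"
    proof
      fix x assume x: "x \<in> F"
      show "x \<in> G \<union> (\<Union>i. N i)"
      proof (cases "\<forall>i. x $ i \<in> D i")
        case False
        then obtain i where "x $ i \<notin> D i" by blast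
        hence "x \<in> N i" using x F(2) by (auto simp: N_def)
        thus ?thesis by blast
      qed (use x in \<open>auto simp: G_def\<close>)
    qed
    hence "emeasure ?\<nu> F \<le> emeasure ?\<nu> (G \<union> (\<Union>i. N i))"
      using borel sets_\<nu> by (intro emeasure_mono) auto
    also have "\<dots> \<le> emeasure ?\<nu> G + emeasure ?\<nu> (\<Union>i. N i)"
      using borel sets_\<nu> by (intro emeasure_subadditive) auto
    also have "\<dots> \<le> 0 + (\<Sum>i\<in>UNIV. emeasure ?\<nu> (N i))"
      using borel sets_\<nu> by (intro add_mono emeasure_subadditive_finite) (auto simp: G0)
    also have "\<dots> \<le> (\<Sum>i\<in>UNIV. e * (\<Prod>m\<in>UNIV - {i}. hausdorff_outer (s $ m) (E m)))"
      using N by (simp add: sum_mono)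
    also have "\<dots> = e * Q" by (simp add: Q_def sum_distrib_left)
    also have "\<dots> = ennreal (p / (q + 1) * q)" using p q by (simp add: e_def flip: ennreal_mult)
    also have "\<dots> \<le> ennreal p" using p q by (intro ennreal_leI) (simp add: field_simps)
    finally show False using p(2) by simp
  qed
  moreover have "emeasure (hausdorff_restrict (s $ i) (E i)) (D i \<inter> cball y r)
      \<le> ennreal ((1 + (\<Sum>i\<in>UNIV. K i)) * r powr (s $ i))" if r: "0 < r" for i y r
  proof -
    have "emeasure (hausdorff_restrict (s $ i) (E i)) (D i \<inter> cball y r) = hausdorff_outer (s $ i) (E i \<inter> (D i \<inter> cball y r))"
      using E D by (intro emeasure_hausdorff_restrict) auto
    also have "E i \<inter> (D i \<inter> cball y r) = D i \<inter> cball y r" using D by blast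
    also have "hausdorff_outer (s $ i) \<dots> \<le> ennreal (K i * r powr (s $ i))" by (rule frostman[OF r])
    also have "K i \<le> (\<Sum>i\<in>UNIV. K i)" using K by (intro member_le_sum) auto
    hence "ennreal (K i * r powr (s $ i)) \<le> ennreal ((1 + (\<Sum>i\<in>UNIV. K i)) * r powr (s $ i))"
      by (intro ennreal_leI mult_right_mono) auto
    finally show ?thesis .
  qed
  moreover have "0 < 1 + (\<Sum>i\<in>UNIV. K i)" using K by (simp add: add_pos_nonneg sum_nonneg)
  ultimately show thesis using that[of D "1 + (\<Sum>i\<in>UNIV. K i)"] D unfolding G_def by blast
qed

text \<open>
  The mass distribution principle: the boxes of a cover by boxes of diameter at most \<open>1/4\<close>, hence with
  sides at most 1, together carry the positive mass of the thinned set.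
\<close>

lemma print_measure_pos:
  fixes F :: "(real ^ 'n::{finite,linorder}) set" and s :: "real ^ 'n::{finite,linorder}"
  assumes E: "\<And>i. E i \<in> sets borel" "\<And>i. hausdorff_outer (s $ i) (E i) < \<infinity>"
    and s: "\<And>i. 0 \<le> s $ i" "\<And>i j. i \<le> j \<Longrightarrow> s $ j \<le> s $ i"
    and F: "F \<in> sets borel" "F \<subseteq> {x. \<forall>i. x $ i \<in> E i}"
    and pos: "0 < emeasure (hausdorff_product s E) F"
    and tail: "\<And>k. (\<Sum>i\<in>{k..}. \<alpha> $ i) \<le> (\<Sum>i\<in>{k..}. s $ i)"
  shows "0 < print_measure \<alpha> F"
proof -
  let ?\<nu> = "hausdorff_product s E" and ?M = "\<lambda>i. hausdorff_restrict (s $ i) (E i)"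
  have sets_\<nu>: "sets ?\<nu> = sets borel" by (simp add: hausdorff_product_def)
  have sets_M: "sets (?M i) = sets borel" for i by (simp add: hausdorff_restrict_def)
  have "finite_measure (?M i)" for i
    using E[of i] by (intro finite_measureI) (simp add: emeasure_hausdorff_restrict hausdorff_restrict_def[THEN arg_cong[where f = space]])
  hence psf: "product_sigma_finite ?M"
    unfolding product_sigma_finite_def using finite_measure.axioms(1) by blast
  obtain D K where D: "\<And>i. D i \<in> sets borel" and K: "0 < K" and
    frostman: "\<And>i y r. 0 < r \<Longrightarrow> emeasure (?M i) (D i \<inter> cball y r) \<le> ennreal (K * r powr (s $ i))"
    and G: "0 < emeasure ?\<nu> (F \<inter> {x. \<forall>i. x $ i \<in> D i})"
    by (rule hausdorff_product_frostman[OF E s(1) F pos]) (rule that)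
  obtain C where C: "0 < C" and box: "\<And>l B \<alpha>. open_box l B \<Longrightarrow> (\<And>i. l $ i \<le> 1) \<Longrightarrow>
       (\<And>k. (\<Sum>i\<in>{k..}. \<alpha> $ i) \<le> (\<Sum>i\<in>{k..}. s $ i)) \<Longrightarrow>
       emeasure (distr (Pi\<^sub>M UNIV ?M) borel (\<lambda>x. \<chi> i. x i)) (B \<inter> {x. \<forall>i. x $ i \<in> D i})
         \<le> ennreal (C * vec_powr l \<alpha>)"
    using box_measure_le_vec_powr[of ?M D K s] psf sets_M D K frostman s(2) by blast
  let ?G = "F \<inter> {x. \<forall>i. x $ i \<in> D i}"
  have "emeasure ?\<nu> ?G / ennreal C \<le> print_premeasure \<alpha> (1/4) F"
    unfolding print_premeasure_def
  proof (rule INF_greatest, clarify)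
    fix J :: "nat set" and l B
    assume cov: "F \<subseteq> (\<Union>j\<in>J. B j)" and B: "\<forall>j\<in>J. open_box (l j) (B j) \<and> diameter (B j) \<le> 1/4"
    have borel: "B j \<inter> {x. \<forall>i. x $ i \<in> D i} \<in> sets ?\<nu>" if "j \<in> J" for j
      using that B open_open_box unfolding sets_\<nu>
      by (intro sets.Int borel_coordinatewise D borel_open) blast
    have "emeasure ?\<nu> ?G \<le> emeasure ?\<nu> (\<Union>j\<in>J. B j \<inter> {x. \<forall>i. x $ i \<in> D i})"
      using cov borel by (intro emeasure_mono sets.countable_UN') auto
    also have "\<dots> \<le> ennreal C * (\<Sum>\<^sub>\<infinity>j\<in>J. ennreal (vec_powr (l j) \<alpha>))"
    proof (rule emeasure_UN_le_infsum[OF borel])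
      fix j assume j: "j \<in> J"
      have "l j $ i \<le> 1" for i
        using open_box_side_le_diameter[of "l j" "B j" i] B j by fastforce
      hence "emeasure ?\<nu> (B j \<inter> {x. \<forall>i. x $ i \<in> D i}) \<le> ennreal (C * vec_powr (l j) \<alpha>)"
        unfolding hausdorff_product_def using B j tail by (intro box) auto
      thus "emeasure ?\<nu> (B j \<inter> {x. \<forall>i. x $ i \<in> D i}) \<le> ennreal C * ennreal (vec_powr (l j) \<alpha>)"
        using C by (simp add: ennreal_mult' less_imp_le)
    qed
    finally show "emeasure ?\<nu> ?G / ennreal C \<le> (\<Sum>\<^sub>\<infinity>j\<in>J. ennreal (vec_powr (l j) \<alpha>))"
      using C by (intro divide_le_posI_ennreal) auto
  qed
  moreover have "0 < emeasure ?\<nu> ?G / ennreal C" using G by (simp add: ennreal_zero_less_divide)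
  moreover have "print_premeasure \<alpha> (1/4) F \<le> print_measure \<alpha> F"
    unfolding print_measure_eq_SUP by (intro SUP_upper) auto
  ultimately show ?thesis by (meson less_le_trans)
qed

section \<open>Optimal covers\<close>

lemma covering_number_attained:
  fixes A :: "'a::metric_space set"
  assumes "compact A" "0 < \<rho>"
  obtains C where "finite C" "A \<subseteq> \<Union>C" "\<And>U. U \<in> C \<Longrightarrow> bounded U \<and> diameter U \<le> \<rho>"
    "card C = covering_number A \<rho>"
proof -
  let ?P = "\<lambda>C. finite C \<and> A \<subseteq> \<Union>C \<and> (\<forall>U\<in>C. bounded U \<and> diameter U \<le> \<rho>)"
  obtain X where X: "finite X" "A \<subseteq> (\<Union>x\<in>X. ball x (\<rho> / 2))"
    using compactE_image[OF assms(1), of A "\<lambda>x. ball x (\<rho> / 2)"] assms(2)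
    by (metis UN_I centre_in_ball half_gt_zero open_ball subsetI)
  have "diameter (ball x (\<rho> / 2)) \<le> \<rho>" for x :: 'a
    unfolding diameter_def
  proof (auto intro!: cSUP_least)
    fix y z assume "dist x y * 2 < \<rho>" "dist x z * 2 < \<rho>"
    thus "dist y z \<le> \<rho>" using dist_triangle[of y z x] by (simp add: dist_commute)
  qed (use assms(2) in simp)
  hence "?P ((\<lambda>x. ball x (\<rho> / 2)) ` X)" using X by auto
  hence "{card C | C. ?P C} \<noteq> {}" by blast
  hence "Inf {card C | C. ?P C} \<in> {card C | C. ?P C}" by (rule Inf_nat_def1)
  then obtain C where C: "?P C" "card C = Inf {card C | C. ?P C}" by (elim CollectE exE conjE) simp
  show thesis by (rule that[of C]) (use C in \<open>auto simp: covering_number_def\<close>)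
qed

text \<open>
  A set of diameter at most \<open>\<delta> $ i / 4\<close> lies in the open interval of length \<open>\<delta> $ i\<close>
  centred at any of its points, so every choice of one covering set for each factor determines an
  axis-parallel box.
\<close>

lemma cover_by_boxes:
  fixes F :: "(real ^ 'n::{finite,linorder}) set" and E :: "'n \<Rightarrow> real set"
  assumes E: "\<And>i. compact (E i)" and F: "F \<subseteq> {x. \<forall>i. x $ i \<in> E i}"
    and \<delta>: "\<delta> \<in> scales"
  obtains C where "finite C" "F \<subseteq> \<Union>C" "\<And>B. B \<in> C \<Longrightarrow> open_box \<delta> B"
    "card C \<le> (\<Prod>i\<in>UNIV. covering_number (E i) (\<delta> $ i / 4))"
proof -
  have pos: "0 < \<delta> $ i" and dec: "i \<le> j \<Longrightarrow> \<delta> $ j \<le> \<delta> $ i" for i j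
    using \<delta> by (auto simp: scales_def)
  have "\<exists>C. finite C \<and> E i \<subseteq> \<Union>C \<and> (\<forall>U\<in>C. bounded U \<and> diameter U \<le> \<delta> $ i / 4) \<and>
      card C = covering_number (E i) (\<delta> $ i / 4)" for i
    by (rule covering_number_attained[OF E[of i], of "\<delta> $ i / 4"]) (use pos[of i] in auto)
  then obtain C where C: "\<And>i. finite (C i)" "\<And>i. E i \<subseteq> \<Union>(C i)"
    "\<And>i U. U \<in> C i \<Longrightarrow> bounded U \<and> diameter U \<le> \<delta> $ i / 4"
    "\<And>i. card (C i) = covering_number (E i) (\<delta> $ i / 4)"
    by metis
  define pt where "pt U = (SOME x :: real. x \<in> U)" for U
  define corner where "corner \<phi> = (\<chi> i. pt (\<phi> i) - \<delta> $ i / 2)" for \<phi> :: "'n \<Rightarrow> real set"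
  define P where "P \<phi> = (\<lambda>x. corner \<phi> + x) ` {x. \<forall>i. 0 < x $ i \<and> x $ i < \<delta> $ i}" for \<phi>
  let ?I = "Pi\<^sub>E UNIV C"
  show thesis
  proof (rule that[of "P ` ?I"])
    show "finite (P ` ?I)" using C(1) by (intro finite_imageI finite_PiE) auto
    show "F \<subseteq> \<Union>(P ` ?I)"
    proof
      fix x assume x: "x \<in> F"
      have "\<exists>U. U \<in> C i \<and> x $ i \<in> U" for i using x F C(2)[of i] by blast
      then obtain \<phi> where \<phi>: "\<And>i. \<phi> i \<in> C i" "\<And>i. x $ i \<in> \<phi> i" by metis
      have "0 < (x - corner \<phi>) $ i \<and> (x - corner \<phi>) $ i < \<delta> $ i" for i
      proof -
        have "pt (\<phi> i) \<in> \<phi> i" unfolding pt_def using \<phi>(2) by (rule someI)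
        hence "dist (x $ i) (pt (\<phi> i)) \<le> \<delta> $ i / 4"
          using C(3)[OF \<phi>(1)] \<phi>(2) diameter_bounded_bound order_trans by blast
        thus ?thesis using pos[of i] unfolding corner_def dist_real_def
            vector_minus_component vec_lambda_beta by linarith
      qed
      hence "x \<in> P \<phi>" unfolding P_def by (intro image_eqI[of _ _ "x - corner \<phi>"]) auto
      thus "x \<in> \<Union>(P ` ?I)" using \<phi>(1) by auto
    qed
    show "open_box \<delta> B" if B: "B \<in> P ` ?I" for B
    proof -
      obtain \<phi> where "B = P \<phi>" using B by blast
      thus ?thesis unfolding open_box_def P_def using pos dec
        by (intro conjI exI[of _ "\<lambda>x. x"] exI[of _ "corner \<phi>"]) auto
    qed
    have "card (P ` ?I) \<le> card ?I" using C(1) by (intro card_image_le finite_PiE) auto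
    also have "\<dots> = (\<Prod>i\<in>UNIV. covering_number (E i) (\<delta> $ i / 4))"
      using C(1,4) by (simp add: card_PiE)
    finally show "card (P ` ?I) \<le> (\<Prod>i\<in>UNIV. covering_number (E i) (\<delta> $ i / 4))" .
  qed
qed

lemma box_covering_number_le:
  assumes "finite C" "F \<subseteq> \<Union>C" "\<And>B. B \<in> C \<Longrightarrow> \<exists>l. open_box l B \<and> (\<forall>i. l $ i \<le> \<delta> $ i)"
  shows "box_covering_number F \<delta> \<le> card C"
  unfolding box_covering_number_def using assms by (intro wellorder_Inf_le1) blast

text \<open>
  The infimum of the empty set of natural numbers is 0, so the existence of some cover matters here; it
  comes from the compact coordinate projections of \<open>F\<close>.
\<close>

lemma box_covering_number_attained:
  fixes F :: "(real ^ 'n::{finite,linorder}) set"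
  assumes "compact F" "\<delta> \<in> scales"
  obtains C where "finite C" "F \<subseteq> \<Union>C" "\<And>B. B \<in> C \<Longrightarrow> \<exists>l. open_box l B \<and> (\<forall>i. l $ i \<le> \<delta> $ i)"
    "card C = box_covering_number F \<delta>"
proof -
  let ?P = "\<lambda>C. finite C \<and> F \<subseteq> \<Union>C \<and> (\<forall>B\<in>C. \<exists>l. open_box l B \<and> (\<forall>i. l $ i \<le> \<delta> $ i))"
  have proj: "compact ((\<lambda>x. x $ i) ` F)" for i
    using assms(1) by (intro compact_continuous_image continuous_intros)
  obtain C where "finite C" "F \<subseteq> \<Union>C" "\<And>B. B \<in> C \<Longrightarrow> open_box \<delta> B"
    by (rule cover_by_boxes[of "\<lambda>i. (\<lambda>x. x $ i) ` F" F \<delta>]) (use proj assms(2) in auto)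
  hence "?P C" by blast
  hence "{card C | C. ?P C} \<noteq> {}" by blast
  hence "Inf {card C | C. ?P C} \<in> {card C | C. ?P C}" by (rule Inf_nat_def1)
  then obtain C where C: "?P C" "card C = Inf {card C | C. ?P C}" by (elim CollectE exE conjE) simp
  show thesis by (rule that[of C]) (use C in \<open>auto simp: box_covering_number_def\<close>)
qed

section \<open>The lower box dimension print\<close>

lemma eventually_scales_to_zero:
  "eventually P (scales_to_zero :: (real ^ 'n::{finite,linorder}) filter) \<longleftrightarrow>
     (\<exists>d>0. \<forall>\<delta>\<in>scales. \<delta> $ Min UNIV < d \<longrightarrow> P \<delta>)"
proof
  assume "eventually P scales_to_zero"
  then obtain Q where Q: "eventually Q (at_right (0::real))"
      "\<And>\<delta>. Q (\<delta> $ Min UNIV) \<Longrightarrow> \<delta> \<in> scales \<Longrightarrow> P \<delta>"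
    unfolding scales_to_zero_def eventually_inf_principal eventually_filtercomap by blast
  from Q(1) obtain d where d: "d > 0" "\<And>y. 0 < y \<Longrightarrow> y < d \<Longrightarrow> Q y"
    unfolding eventually_at_right_field by blast
  thus "\<exists>d>0. \<forall>\<delta>\<in>scales. \<delta> $ Min UNIV < d \<longrightarrow> P \<delta>"
    using Q(2) by (intro exI[of _ d]) (auto simp: scales_def)
next
  assume "\<exists>d>0. \<forall>\<delta>\<in>scales. \<delta> $ Min UNIV < d \<longrightarrow> P \<delta>"
  then obtain d where d: "0 < d" "\<And>\<delta>. \<delta> \<in> scales \<Longrightarrow> \<delta> $ Min UNIV < d \<Longrightarrow> P \<delta>" by blast
  have "eventually (\<lambda>y. y < d) (at_right (0::real))"
    using d(1) unfolding eventually_at_right_field by blast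
  thus "eventually P scales_to_zero"
    unfolding scales_to_zero_def eventually_inf_principal eventually_filtercomap using d(2) by blast
qed

text \<open>
  A box whose longest side is at most \<open>\<eta>\<close> divided by the dimension has diameter at most \<open>\<eta>\<close>, so an
  optimal box cover at scale \<open>\<delta>\<close> is admissible for the premeasure at \<open>\<eta>\<close>.
\<close>

lemma hausdorff_print_subset_lower_box_print:
  fixes F :: "(real ^ 'n::{finite,linorder}) set"
  assumes F: "compact F"
  shows "hausdorff_print F \<subseteq> lower_box_print F"
proof
  fix \<alpha> assume "\<alpha> \<in> hausdorff_print F"
  hence \<alpha>: "\<alpha> \<in> nonneg_exponents" "0 < print_measure \<alpha> F" by (auto simp: hausdorff_print_def)
  from \<alpha>(2) obtain \<eta> where \<eta>: "0 < \<eta>" "0 < print_premeasure \<alpha> \<eta> F"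
    unfolding print_measure_eq_SUP less_SUP_iff by auto
  obtain c where c: "0 < c" "ennreal c < print_premeasure \<alpha> \<eta> F"
    using ennreal_pos_real_below[OF \<eta>(2)] .
  define n where "n = real CARD('n)"
  have n: "0 < n" by (simp add: n_def)
  have bound: "c \<le> real (box_covering_number F \<delta>) * vec_powr \<delta> \<alpha>"
    if \<delta>: "\<delta> \<in> scales" "\<delta> $ Min UNIV < \<eta> / n" for \<delta>
  proof -
    obtain C where C: "finite C" "F \<subseteq> \<Union>C" "\<And>B. B \<in> C \<Longrightarrow> \<exists>l. open_box l B \<and> (\<forall>i. l $ i \<le> \<delta> $ i)"
      "card C = box_covering_number F \<delta>"
      by (rule box_covering_number_attained[OF F \<delta>(1)]) (rule that)
    from C(3) obtain l where l: "\<And>B. B \<in> C \<Longrightarrow> open_box (l B) B" "\<And>B i. B \<in> C \<Longrightarrow> l B $ i \<le> \<delta> $ i"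
      by metis
    obtain h where h: "bij_betw h {..<card C} C"
      using ex_bij_betw_nat_finite[OF C(1)] by (auto simp: atLeast0LessThan)
    have hC: "h j \<in> C" if "j < card C" for j using h that by (auto simp: bij_betw_def)
    have "print_premeasure \<alpha> \<eta> F \<le> (\<Sum>\<^sub>\<infinity>j\<in>{..<card C}. ennreal (vec_powr (l (h j)) \<alpha>))"
      unfolding print_premeasure_def
    proof (rule INF_lower2[of "({..<card C}, \<lambda>j. l (h j), h)"])
      have "diameter (h j) \<le> \<eta>" if "j < card C" for j
      proof -
        have "diameter (h j) \<le> (\<Sum>i\<in>UNIV. l (h j) $ i)"
          using l(1) hC[OF that] by (intro open_box_bounded_diameter)
        also have "\<dots> \<le> (\<Sum>i\<in>(UNIV::'n set). \<delta> $ Min UNIV)"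
        proof (rule sum_mono)
          fix i
          have "\<delta> $ i \<le> \<delta> $ Min UNIV" using \<delta>(1) by (simp add: scales_def)
          thus "l (h j) $ i \<le> \<delta> $ Min UNIV" using l(2)[OF hC[OF that], of i] by simp
        qed
        also have "\<dots> \<le> \<eta>" using \<delta>(2) n by (simp add: n_def field_simps)
        finally show ?thesis .
      qed
      moreover have "F \<subseteq> (\<Union>j\<in>{..<card C}. h j)" using C(2) h by (simp add: bij_betw_def)
      ultimately show "({..<card C}, \<lambda>j. l (h j), h) \<in> {(J, l, B). F \<subseteq> (\<Union>j\<in>J. B j) \<and>
          (\<forall>j\<in>J. open_box (l j) (B j) \<and> diameter (B j) \<le> \<eta>)}"
        using l(1) hC by auto
    qed simp
    also have "\<dots> = (\<Sum>j<card C. ennreal (vec_powr (l (h j)) \<alpha>))" by simp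
    also have "\<dots> \<le> (\<Sum>j<card C. ennreal (vec_powr \<delta> \<alpha>))"
    proof (intro sum_mono ennreal_leI)
      fix j assume "j \<in> {..<card C}"
      hence j: "h j \<in> C" using hC by simp
      have "0 \<le> l (h j) $ i" for i using l(1)[OF j] by (simp add: open_box_def less_imp_le)
      thus "vec_powr (l (h j)) \<alpha> \<le> vec_powr \<delta> \<alpha>"
        unfolding vec_powr_def using l(2)[OF j] \<alpha>(1)
        by (intro prod_mono) (auto simp: nonneg_exponents_def intro!: powr_mono2)
    qed
    also have "\<dots> = ennreal (real (card C) * vec_powr \<delta> \<alpha>)"
      by (simp add: ennreal_mult' ennreal_of_nat_eq_real_of_nat)
    finally have "ennreal c < ennreal (real (card C) * vec_powr \<delta> \<alpha>)" using c(2) by (rule order.strict_trans2[rotated])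
    thus ?thesis using C(4) by (simp add: ennreal_less_iff c(1) less_imp_le)
  qed
  have "eventually (\<lambda>\<delta>. ereal c \<le> ereal (real (box_covering_number F \<delta>) * vec_powr \<delta> \<alpha>)) scales_to_zero"
    unfolding eventually_scales_to_zero using bound \<eta>(1) n by (intro exI[of _ "\<eta> / n"]) auto
  hence "ereal c \<le> Liminf scales_to_zero (\<lambda>\<delta>. ereal (real (box_covering_number F \<delta>) * vec_powr \<delta> \<alpha>))"
    by (rule Liminf_bounded)
  moreover have "0 < ereal c" using c(1) by simp
  ultimately have "0 < Liminf scales_to_zero (\<lambda>\<delta>. ereal (real (box_covering_number F \<delta>) * vec_powr \<delta> \<alpha>))"
    by (rule less_le_trans[rotated])
  thus "\<alpha> \<in> lower_box_print F" using \<alpha>(1) by (simp add: lower_box_print_def)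
qed

lemma eventually_covering_number_le:
  assumes "upper_box_dim A < ereal t"
  shows "eventually (\<lambda>\<rho>. real (covering_number A \<rho>) \<le> \<rho> powr (- t)) (at_right 0)"
proof -
  have "eventually (\<lambda>\<rho>. ereal (ln (real (covering_number A \<rho>)) / - ln \<rho>) < ereal t) (at_right 0)"
    using assms unfolding upper_box_dim_def by (rule Limsup_lessD)
  moreover have "eventually (\<lambda>\<rho>::real. 0 < \<rho> \<and> \<rho> < 1) (at_right 0)"
    unfolding eventually_at_right_field by (intro exI[of _ 1]) auto
  ultimately show ?thesis
  proof eventually_elim
    case (elim \<rho>)
    have "0 < - ln \<rho>" using elim by simp
    hence "ln (real (covering_number A \<rho>)) < t * (- ln \<rho>)" using elim by (simp add: field_simps)
    hence "real (covering_number A \<rho>) \<le> exp (t * (- ln \<rho>))"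
    proof (cases "covering_number A \<rho> = 0")
      case False
      hence "real (covering_number A \<rho>) = exp (ln (real (covering_number A \<rho>)))" by simp
      thus ?thesis using \<open>ln _ < _\<close> by (metis exp_le_cancel_iff less_imp_le)
    qed simp
    thus ?case using elim by (simp add: powr_def)
  qed
qed

text \<open>
  The first entries of the scale vector are kept much larger than the entries from \<open>k\<close> on. Both the
  covering number and the monomial factorise over the coordinates up to constants, so the excess of the
  tail sum of \<open>\<alpha>\<close> then outweighs whatever the first coordinates contribute.
\<close>

lemma lower_box_print_tail_sums:
  fixes F :: "(real ^ 'n::{finite,linorder}) set" and s :: "real ^ 'n::{finite,linorder}"
  assumes E: "\<And>i. compact (E i)" "\<And>i. upper_box_dim (E i) \<le> ereal (s $ i)"
    and F: "F \<subseteq> {x. \<forall>i. x $ i \<in> E i}" and \<alpha>: "\<alpha> \<in> lower_box_print F"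
  shows "(\<Sum>i\<in>{k..}. \<alpha> $ i) \<le> (\<Sum>i\<in>{k..}. s $ i)"
proof (rule ccontr)
  assume "\<not> ?thesis"
  hence gap: "0 < (\<Sum>i\<in>{k..}. \<alpha> $ i - s $ i)" by (simp add: sum_subtractf)
  define n where "n = real CARD('n)"
  have n: "0 < n" by (simp add: n_def)
  \<comment> \<open>Summed over the tail, the losses \<open>\<epsilon>\<close> consume at most half of the gap.\<close>
  define \<epsilon> where "\<epsilon> = (\<Sum>i\<in>{k..}. \<alpha> $ i - s $ i) / (2 * n)"
  have \<epsilon>: "0 < \<epsilon>" using gap n by (simp add: \<epsilon>_def)
  define \<gamma> where "\<gamma> i = \<alpha> $ i - s $ i - \<epsilon>" for i
  define b where "b = (\<Sum>i\<in>{k..}. \<gamma> i)"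
  have b: "0 < b"
  proof -
    have "card {k..} \<le> CARD('n)" by (intro card_mono) auto
    hence "(\<Sum>i\<in>{k..}. \<epsilon>) \<le> n * \<epsilon>" using \<epsilon> by (simp add: n_def)
    also have "\<dots> < (\<Sum>i\<in>{k..}. \<alpha> $ i - s $ i)" using gap n by (simp add: \<epsilon>_def)
    finally show ?thesis by (simp add: b_def \<gamma>_def sum_subtractf)
  qed
  obtain c where c: "0 < c" "\<forall>\<^sub>F \<delta> in scales_to_zero. c < real (box_covering_number F \<delta>) * vec_powr \<delta> \<alpha>"
  proof -
    have "0 < Liminf scales_to_zero (\<lambda>\<delta>. ereal (real (box_covering_number F \<delta>) * vec_powr \<delta> \<alpha>))"
      using \<alpha> by (simp add: lower_box_print_def)
    then obtain c where "ereal 0 < ereal c"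
      "ereal c < Liminf scales_to_zero (\<lambda>\<delta>. ereal (real (box_covering_number F \<delta>) * vec_powr \<delta> \<alpha>))"
      using ereal_dense2[of 0] by (auto simp: zero_ereal_def)
    thus thesis using that[of c] less_LiminfD by fastforce
  qed
  then obtain d where d: "0 < d"
    "\<And>\<delta>. \<delta> \<in> scales \<Longrightarrow> \<delta> $ Min UNIV < d \<Longrightarrow> c < real (box_covering_number F \<delta>) * vec_powr \<delta> \<alpha>"
    unfolding eventually_scales_to_zero by blast
  have "\<forall>i. \<forall>\<^sub>F \<rho> in at_right 0. real (covering_number (E i) \<rho>) \<le> \<rho> powr (- (s $ i + \<epsilon>))"
  proof
    fix i
    have "upper_box_dim (E i) < ereal (s $ i + \<epsilon>)"
      using E(2)[of i] \<epsilon> by (intro le_less_trans[OF E(2)[of i]]) simp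
    thus "\<forall>\<^sub>F \<rho> in at_right 0. real (covering_number (E i) \<rho>) \<le> \<rho> powr (- (s $ i + \<epsilon>))"
      by (rule eventually_covering_number_le)
  qed
  hence "\<forall>\<^sub>F \<rho> in at_right 0. \<forall>i. real (covering_number (E i) \<rho>) \<le> \<rho> powr (- (s $ i + \<epsilon>))"
    by (intro eventually_all_finite) blast
  then obtain d' where d': "0 < d'"
    "\<And>\<rho> i. 0 < \<rho> \<Longrightarrow> \<rho> < d' \<Longrightarrow> real (covering_number (E i) \<rho>) \<le> \<rho> powr (- (s $ i + \<epsilon>))"
    unfolding eventually_at_right_field by blast
  define a where "a = (\<Sum>i\<in>{..<k}. \<gamma> i)"
  \<comment> \<open>The total exponent of \<open>t\<close> will be \<open>a + m * b\<close>; \<open>m \<ge> 1\<close> keeps the scale vector decreasing.\<close>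
  define m where "m = max 1 ((1 - a) / b)"
  have m: "1 \<le> m" "1 \<le> a + m * b"
  proof -
    show "1 \<le> m" by (simp add: m_def)
    have "(1 - a) / b \<le> m" by (simp add: m_def)
    thus "1 \<le> a + m * b" using b by (simp add: pos_divide_le_eq)
  qed
  define A where "A = (\<Prod>i\<in>UNIV. 4 powr (s $ i + \<epsilon>))"
  have A: "0 < A" by (auto simp: A_def intro!: prod_pos)
  define t where "t = min (min (1/2) (d / 2)) (min (d' / 2) (c / A))"
  have t: "0 < t" "t < 1" "t < d" "t < d'" "t \<le> c / A"
    using d d' c A by (auto simp: t_def min_less_iff_disj)
  define \<delta> where "\<delta> = (\<chi> i :: 'n. if i < k then t else t powr m)"
  have tm: "0 < t powr m" "t powr m \<le> t"
    using t m powr_mono'[of 1 m t] by auto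
  have \<delta>: "0 < \<delta> $ i" "\<delta> $ i \<le> t" "i \<le> j \<Longrightarrow> \<delta> $ j \<le> \<delta> $ i" for i j
    unfolding \<delta>_def vec_lambda_beta using t(1) tm by (auto simp del: powr_gt_zero)
  have scales: "\<delta> \<in> scales" using \<delta> t(2) by (auto simp: scales_def intro: le_less_trans)
  obtain C where C: "finite C" "F \<subseteq> \<Union>C" "\<And>B. B \<in> C \<Longrightarrow> open_box \<delta> B"
    "card C \<le> (\<Prod>i\<in>UNIV. covering_number (E i) (\<delta> $ i / 4))"
    by (rule cover_by_boxes[OF E(1) F scales]) (rule that)
  have "box_covering_number F \<delta> \<le> card C"
    using C(3) by (intro box_covering_number_le[OF C(1,2)]) blast
  hence "real (box_covering_number F \<delta>) \<le> real (\<Prod>i\<in>UNIV. covering_number (E i) (\<delta> $ i / 4))"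
    using C(4) by linarith
  also have "\<dots> = (\<Prod>i\<in>UNIV. real (covering_number (E i) (\<delta> $ i / 4)))" by simp
  also have "\<dots> \<le> (\<Prod>i\<in>UNIV. (\<delta> $ i / 4) powr (- (s $ i + \<epsilon>)))"
  proof (rule prod_mono)
    fix i
    have "\<delta> $ i / 4 < d'" using \<delta>(1,2)[of i] t(4) by linarith
    thus "0 \<le> real (covering_number (E i) (\<delta> $ i / 4)) \<and>
        real (covering_number (E i) (\<delta> $ i / 4)) \<le> (\<delta> $ i / 4) powr (- (s $ i + \<epsilon>))"
      using d'(2)[of "\<delta> $ i / 4" i] \<delta>(1)[of i] by simp
  qed
  finally have "real (box_covering_number F \<delta>) * vec_powr \<delta> \<alpha>
      \<le> (\<Prod>i\<in>UNIV. (\<delta> $ i / 4) powr (- (s $ i + \<epsilon>))) * vec_powr \<delta> \<alpha>"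
    by (intro mult_right_mono) (auto simp: vec_powr_def intro: prod_nonneg)
  also have "\<dots> = (\<Prod>i\<in>UNIV. 4 powr (s $ i + \<epsilon>) * \<delta> $ i powr \<gamma> i)"
    unfolding vec_powr_def prod.distrib[symmetric]
  proof (rule prod.cong[OF refl])
    fix i
    have "\<delta> $ i powr \<gamma> i = \<delta> $ i powr (- (s $ i + \<epsilon>)) * \<delta> $ i powr (\<alpha> $ i)"
      unfolding powr_add[symmetric] by (simp add: \<gamma>_def algebra_simps)
    moreover have "(\<delta> $ i / 4) powr (- p) = 4 powr p * \<delta> $ i powr (- p)" for p
      using \<delta>(1)[of i] by (simp add: powr_divide powr_minus_divide)
    ultimately show "(\<delta> $ i / 4) powr (- (s $ i + \<epsilon>)) * \<delta> $ i powr (\<alpha> $ i) = 4 powr (s $ i + \<epsilon>) * \<delta> $ i powr \<gamma> i"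
      by (simp only: mult.assoc)
  qed
  also have "\<dots> = A * (\<Prod>i\<in>UNIV. \<delta> $ i powr \<gamma> i)" by (simp add: A_def prod.distrib)
  also have "(\<Prod>i\<in>UNIV. \<delta> $ i powr \<gamma> i) = (\<Prod>i\<in>{..<k}. \<delta> $ i powr \<gamma> i) * (\<Prod>i\<in>{k..}. \<delta> $ i powr \<gamma> i)"
    by (subst prod.union_disjoint[symmetric]) (auto intro!: prod.cong)
  also have "(\<Prod>i\<in>{..<k}. \<delta> $ i powr \<gamma> i) = t powr a"
    using t(1) by (simp add: \<delta>_def a_def powr_sum)
  also have "(\<Prod>i\<in>{k..}. \<delta> $ i powr \<gamma> i) = (\<Prod>i\<in>{k..}. t powr (m * \<gamma> i))"
    by (intro prod.cong) (auto simp: \<delta>_def powr_powr)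
  also have "\<dots> = t powr (m * b)"
    using t(1) by (simp add: b_def powr_sum sum_distrib_left)
  also have "t powr a * t powr (m * b) = t powr (a + m * b)" by (simp add: powr_add)
  also have "\<dots> \<le> t powr 1" using t m by (intro powr_mono') auto
  finally have "real (box_covering_number F \<delta>) * vec_powr \<delta> \<alpha> \<le> A * t"
    using A t by (simp add: mult_left_mono)
  also have "\<dots> \<le> c" using t(5) A by (simp add: field_simps)
  finally show False using d(2)[OF scales] \<delta>(2)[of "Min UNIV"] t(3) by simp
qed

section \<open>The common value of the two prints\<close>

theorem proposition5p3:
  fixes F :: "(real ^ 'n::{finite,linorder}) set"
    and E :: "'n \<Rightarrow> real set"
    and s :: "real ^ 'n::{finite,linorder}"
  assumes "F \<noteq> {}" and "compact F"
    and "\<And>i. compact (E i)"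
    and "\<And>i. 0 \<le> s $ i" and "\<And>i. s $ i \<le> 1"
    and "\<And>i j. i \<le> j \<Longrightarrow> s $ j \<le> s $ i"
    and "F \<subseteq> {x. \<forall>i. x $ i \<in> E i}"
    and "\<And>i. 0 < emeasure (hausdorff_measure (s $ i)) (E i)"
    and "\<And>i. emeasure (hausdorff_measure (s $ i)) (E i) < \<infinity>"
    and "\<And>i. upper_box_dim (E i) = ereal (s $ i)"
    and "emeasure (hausdorff_product s E) F > 0"
  shows "hausdorff_print F = lower_box_print F \<and>
         lower_box_print F = {\<alpha> \<in> nonneg_exponents.
            \<forall>k. (\<Sum>i\<in>{k..}. \<alpha> $ i) \<le> (\<Sum>i\<in>{k..}. s $ i)}"
proof
  have borel: "E i \<in> sets borel" for i using assms(3) by (simp add: borel_compact)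
  have fin: "hausdorff_outer (s $ i) (E i) < \<infinity>" for i
    using assms(9)[of i] borel by (simp add: emeasure_hausdorff_measure)
  let ?T = "{\<alpha> \<in> nonneg_exponents. \<forall>k. (\<Sum>i\<in>{k..}. \<alpha> $ i) \<le> (\<Sum>i\<in>{k..}. s $ i)}"
  have "?T \<subseteq> hausdorff_print F"
    using print_measure_pos[OF borel fin assms(4,6) borel_compact[OF assms(2)] assms(7,11)]
    by (auto simp: hausdorff_print_def)
  moreover have "hausdorff_print F \<subseteq> lower_box_print F"
    by (rule hausdorff_print_subset_lower_box_print[OF assms(2)])
  moreover have "lower_box_print F \<subseteq> ?T"
    using lower_box_print_tail_sums[OF assms(3) _ assms(7)] assms(10)
    by (auto simp: lower_box_print_def)
  ultimately show "hausdorff_print F = lower_box_print F" "lower_box_print F = ?T" by blast+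
qed

end
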